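(* Let $n\ge1$ be an integer, $d_3=\gcd(3,n)$ and $d_5=\gcd(5,n)$, and let $\mathcal{Z}(n)=[\mathbb{Z}_2]$ if $n$ is even and $\mathcal{Z}(n)=[\mathbb{Z}_2^-]$ if $n$ is odd. Then $$[\mathbb{Z}_{2n}^-]\circledcirc[\mathbb{T}\oplus\mathbb{Z}_2^c]=\{[\mathbb{1}],[\mathbb{Z}_{d_3}],\mathcal{Z}(n)\},\qquad [\mathbb{Z}_{2n}^-]\circledcirc[\mathbb{I}\oplus\mathbb{Z}_2^c]=\{[\mathbb{1}],\mathcal{Z}(n),[\mathbb{Z}_{d_3}],[\mathbb{Z}_{d_5}]\},$$ $$[\mathbb{Z}_{2n}^-]\circledcirc[\mathbb{O}\oplus\mathbb{Z}_2^c]=\begin{cases}\{[\mathbb{1}],[\mathbb{Z}_2],[\mathbb{Z}_{d_3}],[\mathbb{Z}_4]\}&\text{if } n\text{ is even and }4\mid n,\\ \{[\mathbb{1}],[\mathbb{Z}_2],[\mathbb{Z}_{d_3}],[\mathbb{Z}_4^-]\}&\text{if } n\text{ is even but }4\nmid n,\\ \{[\mathbb{1}],[\mathbb{Z}_2^-],[\mathbb{Z}_{d_3}]\}&\text{if } n\text{ is odd}.\end{cases}$$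
   Context: $[K]$ is the conjugacy class of a subgroup $K$ in $\mathrm{O}(3)$, and the clips operation is $[H_1]\circledcirc[H_2]=\{[H_1\cap gH_2g^{-1}]:g\in\mathrm{O}(3)\}$. $(e_1,e_2,e_3)$ is the canonical basis of $\mathbb{R}^3$, $\mathbf{r}(n,\theta)$ is the rotation by angle $\theta$ about the axis directed by $n\neq0$. $\mathbb{1}=\{\mathrm{Id}\}$; $\mathbb{Z}_2^c=\{\pm\mathrm{Id}\}$; $H\oplus\mathbb{Z}_2^c=H\cup(-H)$ for $H\subset\mathrm{SO}(3)$; $\mathbb{Z}_k=\{\mathbf{r}(e_3,2j\pi/k):0\le j\le k-1\}$, with $\mathbb{Z}_1=\mathbb{1}$; $\mathbb{Z}_{2k}^-=\mathbb{Z}_k\cup(-\mathbf{r}(e_3,\pi/k))\mathbb{Z}_k$ for $k\ge1$. $\mathbb{T}$ is the rotation group of the regular tetrahedron (order 12), generated by $\mathbf{r}(e_3,\pi),\mathbf{r}(e_1,\pi),\mathbf{r}(e_1+e_2+e_3,2\pi/3)$; $\mathbb{O}$ is the rotation group of the cube (order 24), generated by $\mathbf{r}(e_3,\pi/2),\mathbf{r}(e_1,\pi),\mathbf{r}(e_1+e_2+e_3,2\pi/3)$; $\mathbb{I}$ is the rotation group of the regular icosahedron (order 60), generated by $\mathbf{r}(e_3,\pi),\mathbf{r}(e_1+e_2+e_3,2\pi/3),\mathbf{r}(e_1+\phi e_3,2\pi/5)$ with $\phi=(1+\sqrt5)/2$. *)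

theory Defs
  imports
    "HOL-Analysis.Analysis"
    "HOL-Algebra.Generated_Groups"
    "HOL-Algebra.Group_Action"
begin

section \<open>The group O(3), conjugacy classes and clips\<close>

definition O3 :: "(real^3^3) monoid" where
  "O3 = \<lparr>carrier = {A. orthogonal_matrix A}, mult = (**), one = mat 1\<rparr>"

definition conj_by :: "real^3^3 \<Rightarrow> (real^3^3) set \<Rightarrow> (real^3^3) set" where
  "conj_by g H = g <#\<^bsub>O3\<^esub> H #>\<^bsub>O3\<^esub> inv\<^bsub>O3\<^esub> g"

definition conj_class :: "(real^3^3) set \<Rightarrow> (real^3^3) set set" where
  "conj_class K = orbit O3 conj_by K"

text \<open>
  The clips operation takes conjugacy classes as arguments.  Lemma \<open>clips_conj_class\<close> below shows
  that it may be computed on fixed representatives, varying only the conjugating element.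
\<close>

definition clips :: "(real^3^3) set set \<Rightarrow> (real^3^3) set set \<Rightarrow> (real^3^3) set set set"
    (infixl \<open>clips\<close> 70) where
  "C clips D = {conj_class (H \<inter> conj_by g K) | H K g. H \<in> C \<and> K \<in> D \<and> g \<in> carrier O3}"

lemma orthogonal_matrix_inv3:
  fixes A :: "real^3^3"
  assumes "orthogonal_matrix A"
  shows "transpose A ** A = mat 1" "A ** transpose A = mat 1"
  using assms by (simp_all add: orthogonal_matrix_def)

lemma group_O3: "group O3"
proof (rule groupI)
  fix x assume "x \<in> carrier O3"
  then show "\<exists>y\<in>carrier O3. y \<otimes>\<^bsub>O3\<^esub> x = \<one>\<^bsub>O3\<^esub>"
    by (intro bexI[of _ "transpose x"]) (simp_all add: O3_def orthogonal_matrix_def)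
qed (simp_all add: O3_def orthogonal_matrix_mul orthogonal_matrix_id matrix_mul_assoc)

interpretation O3: group O3
  by (rule group_O3)

lemma inv_O3: "orthogonal_matrix A \<Longrightarrow> inv\<^bsub>O3\<^esub> A = transpose A"
  by (rule O3.inv_equality) (simp_all add: O3_def orthogonal_matrix_def)

lemma conj_by_image:
  "conj_by g H = (\<lambda>h. g \<otimes>\<^bsub>O3\<^esub> h \<otimes>\<^bsub>O3\<^esub> inv\<^bsub>O3\<^esub> g) ` H"
  by (auto simp: conj_by_def l_coset_def r_coset_def)

lemma conj_by_mult:
  assumes "a \<in> carrier O3" "b \<in> carrier O3" "H \<subseteq> carrier O3"
  shows "conj_by a (conj_by b H) = conj_by (a \<otimes>\<^bsub>O3\<^esub> b) H"
  unfolding conj_by_image image_image using assms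
  by (intro image_cong refl) (auto simp: O3.inv_mult_group O3.m_assoc subset_iff)

lemma conj_by_one: "H \<subseteq> carrier O3 \<Longrightarrow> conj_by \<one>\<^bsub>O3\<^esub> H = H"
  unfolding conj_by_image by (force simp: subset_iff)

lemma conj_by_subset:
  "a \<in> carrier O3 \<Longrightarrow> H \<subseteq> carrier O3 \<Longrightarrow> conj_by a H \<subseteq> carrier O3"
  unfolding conj_by_image by auto

lemma conj_by_Int:
  assumes "a \<in> carrier O3" "H \<subseteq> carrier O3" "K \<subseteq> carrier O3"
  shows "conj_by a (H \<inter> K) = conj_by a H \<inter> conj_by a K"
  unfolding conj_by_image using assms
  by (intro inj_on_image_Int[of _ "carrier O3"]) (auto simp: inj_on_def)

lemma conj_class_conj_by:
  assumes a: "a \<in> carrier O3" and H: "H \<subseteq> carrier O3"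
  shows "conj_class (conj_by a H) = conj_class H"
proof -
  have "\<exists>g\<in>carrier O3. conj_by b H = conj_by g (conj_by a H)" if b: "b \<in> carrier O3" for b
    by (rule bexI[of _ "b \<otimes>\<^bsub>O3\<^esub> inv\<^bsub>O3\<^esub> a"])
       (use a b H in \<open>auto simp: conj_by_mult O3.m_assoc\<close>)
  moreover have "\<exists>g\<in>carrier O3. conj_by b (conj_by a H) = conj_by g H" if "b \<in> carrier O3" for b
    using a H that by (auto simp: conj_by_mult)
  ultimately show ?thesis
    unfolding conj_class_def orbit_def by blast
qed

lemma clips_conj_class:
  assumes "subgroup H O3" "subgroup K O3"
  shows "conj_class H clips conj_class K
           = {conj_class (H \<inter> conj_by g K) | g. g \<in> carrier O3}"
proof
  have HK: "H \<subseteq> carrier O3" "K \<subseteq> carrier O3"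
    using assms by (auto dest: subgroup.subset)
  show "{conj_class (H \<inter> conj_by g K) | g. g \<in> carrier O3} \<subseteq> conj_class H clips conj_class K"
  proof -
    have "H \<in> conj_class H" "K \<in> conj_class K"
      using HK conj_by_one O3.one_closed unfolding conj_class_def orbit_def by blast+
    then show ?thesis unfolding clips_def by blast
  qed
  show "conj_class H clips conj_class K \<subseteq> {conj_class (H \<inter> conj_by g K) | g. g \<in> carrier O3}"
  proof
    fix C assume "C \<in> conj_class H clips conj_class K"
    then obtain a b g where abg: "a \<in> carrier O3" "b \<in> carrier O3" "g \<in> carrier O3"
      and C: "C = conj_class (conj_by a H \<inter> conj_by g (conj_by b K))"
      unfolding clips_def conj_class_def orbit_def by blast
    define c where "c = inv\<^bsub>O3\<^esub> a \<otimes>\<^bsub>O3\<^esub> (g \<otimes>\<^bsub>O3\<^esub> b)"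
    have c: "c \<in> carrier O3" using abg by (simp add: c_def)
    have "a \<otimes>\<^bsub>O3\<^esub> c = g \<otimes>\<^bsub>O3\<^esub> b"
      unfolding c_def using abg by (simp flip: O3.m_assoc)
    then have "conj_by a H \<inter> conj_by g (conj_by b K) = conj_by a (H \<inter> conj_by c K)"
      using abg c HK by (simp add: conj_by_Int conj_by_mult conj_by_subset)
    moreover have "conj_class (conj_by a (H \<inter> conj_by c K)) = conj_class (H \<inter> conj_by c K)"
      using abg HK by (intro conj_class_conj_by) auto
    ultimately show "C \<in> {conj_class (H \<inter> conj_by g K) | g. g \<in> carrier O3}"
      using c C by auto
  qed
qed

section \<open>Rotations\<close>

abbreviation e1 :: "real^3" where "e1 \<equiv> axis 1 1"
abbreviation e2 :: "real^3" where "e2 \<equiv> axis 2 1"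
abbreviation e3 :: "real^3" where "e3 \<equiv> axis 3 1"

text \<open>Rodrigues' formula for the rotation by angle \<open>\<theta>\<close> about the axis directed by \<open>n \<noteq> 0\<close>,
  counterclockwise when seen from the tip of \<open>n\<close>.\<close>

definition rot :: "real^3 \<Rightarrow> real \<Rightarrow> real^3^3" where
  "rot n \<theta> = matrix (\<lambda>v. cos \<theta> *\<^sub>R v + sin \<theta> *\<^sub>R cross3 (sgn n) v
                        + ((1 - cos \<theta>) * (sgn n \<bullet> v)) *\<^sub>R sgn n)"

lemma rot_e3:
  "rot e3 \<theta> = vector [vector [cos \<theta>, - sin \<theta>, 0], vector [sin \<theta>, cos \<theta>, 0], vector [0, 0, 1]]"
proof -
  have "sgn e3 = e3"
    by (simp add: sgn_div_norm norm_axis_1)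
  then show ?thesis
    by (simp add: rot_def matrix_def cross3_simps forall_3 axis_def)
qed

section \<open>The subgroups of O(3) that occur\<close>

definition triv_group :: "(real^3^3) set" where
  "triv_group = {mat 1}"

definition oplus_Z2c :: "(real^3^3) set \<Rightarrow> (real^3^3) set" where
  "oplus_Z2c H = H \<union> uminus ` H"

definition Z_rot :: "nat \<Rightarrow> (real^3^3) set" where
  "Z_rot k = {rot e3 (2 * real j * pi / real k) | j. j < k}"

text \<open>\<open>Z_minus (2 * k)\<close> is the group \<open>Z\<close> with lower index \<open>2k\<close> and upper index minus, for
  \<open>k \<ge> 1\<close>; odd arguments have no meaning.\<close>

definition Z_minus :: "nat \<Rightarrow> (real^3^3) set" where
  "Z_minus m = (let k = m div 2 in Z_rot k \<union> ((- rot e3 (pi / real k)) <#\<^bsub>O3\<^esub> Z_rot k))"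

definition tetra_group :: "(real^3^3) set" where
  "tetra_group = generate O3 {rot e3 pi, rot e1 pi, rot (e1 + e2 + e3) (2 * pi / 3)}"

definition octa_group :: "(real^3^3) set" where
  "octa_group = generate O3 {rot e3 (pi / 2), rot e1 pi, rot (e1 + e2 + e3) (2 * pi / 3)}"

definition icosa_group :: "(real^3^3) set" where
  "icosa_group = generate O3
     {rot e3 pi, rot (e1 + e2 + e3) (2 * pi / 3),
      rot (e1 + ((1 + sqrt 5) / 2) *\<^sub>R e3) (2 * pi / 5)}"

end

theory Submission
  imports Defs
begin

text \<open>
  Write \<open>s = - rot e3 (pi / n)\<close>.  Then \<open>Z_minus (2 * n)\<close> is the cyclic group of order \<open>2 * n\<close> generated
  by \<open>s\<close>, because \<open>s\<close> to the power \<open>k\<close> is the rotation by \<open>k * pi / n\<close>, negated when \<open>k\<close> is odd.  Hence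
  every intersection of \<open>Z_minus (2 * n)\<close> with a conjugate of a group is one of its subgroups, and
  there is exactly one of each order \<open>e\<close> dividing \<open>2 * n\<close>; it is \<open>Z_rot e\<close> or \<open>Z_minus e\<close> according
  to the parity of the index \<open>2 * n / e\<close> (lemma \<open>Z_minus_subgroup_eq\<close>).  Only the question of which
  orders \<open>e\<close> occur depends on the second group.

  A conjugate of \<open>H \<union> - H\<close> is closed under negation, so signs are irrelevant for membership: what
  counts is which rotations about \<open>e3\<close> lie in a conjugate of \<open>H\<close>, that is, which rotations about a
  freely chosen axis lie in \<open>H\<close>.  For each axis they form a cyclic group.  If \<open>M\<close> is the set of orders
  of elements of \<open>H\<close>, and each of them is the exact order of the rotations about some axis, then
  precisely the orders \<open>e \<in> M\<close> with \<open>e\<close> dividing \<open>2 * n\<close> occur; this is \<open>clips_Z_minus\<close>.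

  It remains to see that \<open>M\<close> is \<open>{1, 2, 3}\<close> for the tetrahedron, \<open>{1, 2, 3, 5}\<close> for the icosahedron
  and \<open>{1, 2, 3, 4}\<close> for the cube.  The trace \<open>1 + 2 * cos \<theta>\<close> of a rotation determines its order, so
  it suffices to list the traces.  The elements are listed by coset enumeration: the tetrahedral
  group consists of twelve signed permutation matrices, and it has index 2 in the group of the cube
  and index 5 in that of the icosahedron; coset representatives are the identity and a quarter turn
  in the first case, the powers of a rotation of order 5 in the second.  The orders above 1 are realised by the
  obvious symmetry axes; for the cube, order 2 needs an axis through midpoints of opposite edges,
  since the coordinate axes have order 4.  Order 1 is realised by any axis that avoids the finitely
  many axes of the group.
\<close>

section \<open>Matrices of size three\<close>

lemma matrix3_eq_iff:
  "(vector [x, y, z] :: 'a::zero^3) = vector [x', y', z'] \<longleftrightarrow> x = x' \<and> y = y' \<and> z = z'"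
  by (simp add: vec_eq_iff forall_3)

lemma matrix3_mult:
  "(vector [vector [a11, a12, a13], vector [a21, a22, a23], vector [a31, a32, a33]] :: real^3^3)
     ** (vector [vector [b11, b12, b13], vector [b21, b22, b23], vector [b31, b32, b33]] :: real^3^3)
   = (vector
      [vector [a11 * b11 + a12 * b21 + a13 * b31, a11 * b12 + a12 * b22 + a13 * b32, a11 * b13 + a12 * b23 + a13 * b33],
       vector [a21 * b11 + a22 * b21 + a23 * b31, a21 * b12 + a22 * b22 + a23 * b32, a21 * b13 + a22 * b23 + a23 * b33],
       vector [a31 * b11 + a32 * b21 + a33 * b31, a31 * b12 + a32 * b22 + a33 * b32, a31 * b13 + a32 * b23 + a33 * b33]] :: real^3^3)"
  by (simp add: matrix_matrix_mult_def vec_eq_iff forall_3 sum_3)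

lemma matrix3_one:
  "(mat 1 :: real^3^3) = vector [vector [1, 0, 0], vector [0, 1, 0], vector [0, 0, 1]]"
  by (simp add: mat_def vec_eq_iff forall_3)

lemma matrix3_transpose:
  "transpose (vector [vector [a11, a12, a13], vector [a21, a22, a23], vector [a31, a32, a33]] :: real^3^3)
    = vector [vector [a11, a21, a31], vector [a12, a22, a32], vector [a13, a23, a33]]"
  by (simp add: transpose_def vec_eq_iff forall_3)

lemma matrix3_trace:
  "trace (vector [vector [a11, a12, a13], vector [a21, a22, a23], vector [a31, a32, a33]] :: real^3^3)
    = a11 + a22 + a33"
  by (simp add: trace_def sum_3)

lemmas matrix3 = matrix3_mult matrix3_one matrix3_transpose matrix3_trace matrix3_eq_iff

lemma orthogonal_matrixI: "transpose A ** A = mat 1 \<Longrightarrow> orthogonal_matrix (A :: real^3^3)"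
  by (simp add: orthogonal_matrix_def matrix_left_right_inverse)

lemma O3_simps [simp]:
  "x \<otimes>\<^bsub>O3\<^esub> y = x ** y" "\<one>\<^bsub>O3\<^esub> = mat 1" "x \<in> carrier O3 \<longleftrightarrow> orthogonal_matrix x"
  by (simp_all add: O3_def)

lemma matrix_neg_mult: "(- A) ** B = - (A ** (B :: real^3^3))"
  by (simp add: vec_eq_iff matrix_matrix_mult_def sum_negf)

lemma matrix_mult_neg: "A ** (- B) = - (A ** (B :: real^3^3))"
  by (simp add: vec_eq_iff matrix_matrix_mult_def sum_negf)

lemma transpose_neg: "transpose (- A) = - transpose (A :: real^3^3)"
  by (simp add: vec_eq_iff transpose_def)

lemma det_neg3: "det (- A) = - det (A :: real^3^3)"
  by (simp add: det_3)

section \<open>Rotations about an arbitrary axis\<close>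

text \<open>
  The axis need not be a unit vector; its length \<open>s\<close> enters only through \<open>(1 - cos \<theta>) / s\<^sup>2\<close> and
  \<open>sin \<theta> / s\<close>.  For the axes of order 3 and 5 below, the root in \<open>s\<close> drops out of both quotients.
\<close>

lemma rot_vector:
  assumes "s > 0" and "s\<^sup>2 = a\<^sup>2 + b\<^sup>2 + c\<^sup>2"
  shows "rot (vector [a, b, c]) \<theta> =
    vector [vector [cos \<theta> + (1 - cos \<theta>) / s\<^sup>2 * a\<^sup>2, (1 - cos \<theta>) / s\<^sup>2 * (a * b) - sin \<theta> / s * c,
                    (1 - cos \<theta>) / s\<^sup>2 * (a * c) + sin \<theta> / s * b],
            vector [(1 - cos \<theta>) / s\<^sup>2 * (a * b) + sin \<theta> / s * c, cos \<theta> + (1 - cos \<theta>) / s\<^sup>2 * b\<^sup>2,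
                    (1 - cos \<theta>) / s\<^sup>2 * (b * c) - sin \<theta> / s * a],
            vector [(1 - cos \<theta>) / s\<^sup>2 * (a * c) - sin \<theta> / s * b, (1 - cos \<theta>) / s\<^sup>2 * (b * c) + sin \<theta> / s * a,
                    cos \<theta> + (1 - cos \<theta>) / s\<^sup>2 * c\<^sup>2]]"
proof -
  have "norm (vector [a, b, c] :: real^3) = s"
    using assms by (simp add: norm_eq_sqrt_inner inner_vec_def sum_3 real_sqrt_unique flip: power2_eq_square)
  then have "sgn (vector [a, b, c] :: real^3) = vector [a / s, b / s, c / s]"
    by (simp add: sgn_div_norm vec_eq_iff forall_3 divide_inverse)
  then show ?thesis
    unfolding rot_def
    using assms(1)
    by (simp add: matrix_def cross3_def inner_vec_def sum_3 vec_eq_iff forall_3 axis_def)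
       (simp add: field_simps power2_eq_square)
qed

lemma rot_eq_rot_sgn: "rot (sgn u) \<theta> = rot u \<theta>"
  by (cases "u = 0") (simp_all add: rot_def sgn_div_norm)

lemma rot_mult_vec:
  "rot u \<theta> *v v = cos \<theta> *\<^sub>R v + sin \<theta> *\<^sub>R cross3 (sgn u) v + ((1 - cos \<theta>) * (sgn u \<bullet> v)) *\<^sub>R sgn u"
proof -
  have "linear (\<lambda>v. cos \<theta> *\<^sub>R v + sin \<theta> *\<^sub>R cross3 (sgn u) v + ((1 - cos \<theta>) * (sgn u \<bullet> v)) *\<^sub>R sgn u)"
    by (rule linearI) (simp_all add: inner_right_distrib cross3_simps algebra_simps)
  then show ?thesis
    unfolding rot_def by (simp add: matrix_works)
qed

text \<open>
  Rodrigues' formula is built from the inner product and the cross product, and a rotation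
  preserves both.
\<close>

lemma rotation_conj_rot:
  assumes "rotation_matrix g"
  shows "g ** rot u \<theta> ** transpose g = rot (g *v u) \<theta>"
proof -
  have g: "orthogonal_matrix g" "orthogonal_transformation ((*v) g)"
    using assms by (simp_all add: rotation_matrix_def orthogonal_transformation_matrix)
  have sgn: "sgn (g *v u) = g *v sgn u"
    using g(2) by (simp add: sgn_div_norm orthogonal_transformation_norm matrix_vector_mult_scaleR)
  have "(g ** rot u \<theta>) *v v = (rot (g *v u) \<theta> ** g) *v v" for v
    using g(2)
    by (simp add: rot_mult_vec sgn cross_rotation_matrix assms matrix_vector_right_distrib
        matrix_vector_mult_scaleR orthogonal_transformation_def flip: matrix_vector_mul_assoc)
  then have "g ** rot u \<theta> = rot (g *v u) \<theta> ** g"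
    by (simp add: matrix_eq)
  then show ?thesis
    using g(1) by (simp add: orthogonal_matrix_def flip: matrix_mul_assoc)
qed

lemma rotation_to_e3:
  assumes "u \<noteq> 0"
  shows "\<exists>g. rotation_matrix g \<and> (\<forall>\<theta>. g ** rot u \<theta> ** transpose g = rot e3 \<theta>)"
proof -
  have "norm (sgn u) = 1" using assms by (simp add: norm_sgn)
  then obtain h where h: "rotation_matrix h" "h *v e3 = sgn u"
    using rotation_matrix_exists_basis[where k = "3::3" and a = "sgn u"] by auto
  have o: "orthogonal_matrix h" using h(1) by (simp add: rotation_matrix_def)
  have "transpose h *v sgn u = e3"
    using o h(2) by (simp add: matrix_vector_mul_assoc orthogonal_matrix_def flip: h(2))
  moreover have t: "rotation_matrix (transpose h)"
    using h(1) by (simp add: rotation_matrix_def orthogonal_matrix_transpose)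
  ultimately have "transpose h ** rot u \<theta> ** transpose (transpose h) = rot e3 \<theta>" for \<theta>
    using rotation_conj_rot[OF t, of "sgn u" \<theta>] by (simp add: rot_eq_rot_sgn)
  with t show ?thesis by blast
qed

lemma rot_e3_add: "rot e3 a ** rot e3 b = rot e3 (a + b)"
  by (simp add: rot_e3 matrix3 cos_add sin_add)

lemma rot_e3_0: "rot e3 0 = mat 1"
  by (simp add: rot_e3 matrix3)

lemma transpose_rot_e3: "transpose (rot e3 a) = rot e3 (- a)"
  by (simp add: rot_e3 matrix3)

lemma rotation_matrix_rot_e3: "rotation_matrix (rot e3 a)"
proof -
  have "det (rot e3 a) = 1"
    by (simp add: rot_e3 det_3 flip: power2_eq_square)
  then show ?thesis
    by (simp add: rotation_matrix_def orthogonal_matrixI transpose_rot_e3 rot_e3_add rot_e3_0)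
qed

lemma trace_rot_e3: "trace (rot e3 a) = 1 + 2 * cos a"
  by (simp add: rot_e3 matrix3)

lemma rot_e3_cong: "cos a = cos b \<Longrightarrow> sin a = sin b \<Longrightarrow> rot e3 a = rot e3 b"
  by (simp add: rot_e3)

text \<open>
  The trace is the invariant that recovers the order of a rotation without knowing its axis.
\<close>

lemma trace_orthogonal_conj:
  fixes A :: "real^3^3"
  assumes "orthogonal_matrix g"
  shows "trace (g ** A ** transpose g) = trace A"
  using assms trace_mul_sym[of "g ** A" "transpose g"] 
  by (simp add: matrix_mul_assoc orthogonal_matrix_def)

lemma rotation_matrix_rot: "u \<noteq> 0 \<Longrightarrow> rotation_matrix (rot u \<theta>)"
  and trace_rot: "u \<noteq> 0 \<Longrightarrow> trace (rot u \<theta>) = 1 + 2 * cos \<theta>"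
proof -
  assume "u \<noteq> 0"
  then obtain g where g: "rotation_matrix g" "\<And>\<theta>. g ** rot u \<theta> ** transpose g = rot e3 \<theta>"
    using rotation_to_e3 by blast
  have o: "transpose g ** g = mat 1" "orthogonal_matrix g"
    using g(1) by (simp_all add: rotation_matrix_def orthogonal_matrix_def)
  have eq: "rot u \<theta> = transpose g ** rot e3 \<theta> ** transpose (transpose g)"
    using o unfolding g(2)[of \<theta>, symmetric]
    by (simp add: matrix_mul_assoc) (simp flip: matrix_mul_assoc)
  show "rotation_matrix (rot u \<theta>)"
    using g(1) rotation_matrix_rot_e3[of \<theta>] unfolding eq
    by (simp add: rotation_matrix_def orthogonal_matrix_mul orthogonal_matrix_transpose det_mul)
  show "trace (rot u \<theta>) = 1 + 2 * cos \<theta>"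
    using trace_orthogonal_conj[of "transpose g" "rot e3 \<theta>"] o
    by (simp add: eq trace_rot_e3 orthogonal_matrix_transpose)
qed

section \<open>The cyclic group \<open>Z_minus (2 * n)\<close> and its subgroups\<close>

text \<open>
  The \<open>k\<close>-th power of the generator \<open>- rot e3 (pi / n)\<close> of \<open>Z_minus (2 * n)\<close>.
\<close>

definition rotoref :: "nat \<Rightarrow> nat \<Rightarrow> real^3^3" where
  "rotoref n k = (- 1) ^ k *\<^sub>R rot e3 (real k * pi / real n)"

lemma rotoref_even: "even k \<Longrightarrow> rotoref n k = rot e3 (real k * pi / real n)"
  and rotoref_odd: "odd k \<Longrightarrow> rotoref n k = - rot e3 (real k * pi / real n)"
  by (simp_all add: rotoref_def)

lemma rotoref_add: "rotoref n j ** rotoref n k = rotoref n (j + k)"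
proof -
  have "real j * pi / real n + real k * pi / real n = real (j + k) * pi / real n"
    by (simp add: field_simps add_divide_distrib)
  then show ?thesis
    by (cases "even j"; cases "even k")
       (simp_all add: rotoref_even rotoref_odd matrix_neg_mult matrix_mult_neg rot_e3_add)
qed

lemma rot_e3_period: "rot e3 (a + 2 * real k * pi) = rot e3 a"
  by (rule rot_e3_cong) (simp_all add: cos_add sin_add)

lemma Z_rot_eq:
  assumes "n > 0"
  shows "Z_rot n = range (\<lambda>j::nat. rot e3 (2 * real j * pi / real n))"
proof -
  have "rot e3 (2 * real j * pi / real n) = rot e3 (2 * real (j mod n) * pi / real n)" for j
  proof -
    have j: "real j = real n * real (j div n) + real (j mod n)"
      by (metis mult_div_mod_eq of_nat_add of_nat_mult)
    have "2 * real j * pi / real n = 2 * real (j mod n) * pi / real n + 2 * real (j div n) * pi"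
      using assms by (subst j) (simp add: field_simps)
    then show ?thesis by (simp only: rot_e3_period)
  qed
  moreover have "j mod n < n" for j using assms by simp
  ultimately show ?thesis
    unfolding Z_rot_def by blast
qed

lemma Z_minus_eq:
  assumes "n > 0"
  shows "Z_minus (2 * n) = range (rotoref n)"
proof -
  have even: "rot e3 (2 * real j * pi / real n) = rotoref n (2 * j)" for j
    by (simp add: rotoref_even)
  have odd: "- rot e3 (pi / real n) ** rotoref n (2 * j) = rotoref n (Suc (2 * j))" for j
    using rotoref_add[of n 1 "2 * j"] by (simp add: rotoref_odd)
  have "Z_minus (2 * n) = range (\<lambda>j. rotoref n (2 * j)) \<union> range (\<lambda>j. rotoref n (Suc (2 * j)))"
    using assms by (auto simp: Z_minus_def Z_rot_eq even l_coset_def odd)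
  also have "\<dots> = range (rotoref n)"
  proof -
    have "rotoref n k \<in> range (\<lambda>j. rotoref n (2 * j)) \<union> range (\<lambda>j. rotoref n (Suc (2 * j)))" for k
      by (cases "even k") (auto elim!: evenE oddE)
    then show ?thesis by blast
  qed
  finally show ?thesis .
qed

text \<open>
  The subgroup of order \<open>e\<close> of \<open>Z_minus (2 * n)\<close>, for \<open>e\<close> dividing \<open>2 * n\<close>.
\<close>

definition Z_minus_subgroup :: "nat \<Rightarrow> nat \<Rightarrow> (real^3^3) set" where
  "Z_minus_subgroup n e =
     (if even (2 * n div e) then Z_rot e else Z_minus e)"

text \<open>
  Put \<open>d = 2 * n / e\<close>.  The subgroup of order \<open>e\<close> is generated by the \<open>d\<close>-th power of the generator, which
  is a rotation by \<open>2 * pi / e\<close>, negated if \<open>d\<close> is odd.  In the latter case \<open>e\<close> is even and this is the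
  standard generator of \<open>Z_minus e\<close>.
\<close>

lemma Z_minus_subgroup_eq:
  assumes "n > 0" "e dvd 2 * n"
  shows "Z_minus_subgroup n e = rotoref n ` {k. (2 * n div e) dvd k}"
proof -
  obtain d where d: "2 * n = e * d" using assms(2) by blast
  then have pos: "e > 0" "d > 0" using assms(1) by (auto intro!: Nat.gr0I)
  have "{k. d dvd k} = range (\<lambda>j. d * j)" by auto
  then have img: "rotoref n ` {k. d dvd k} = range (\<lambda>j. rotoref n (d * j))"
    by (simp add: image_image)
  have quot: "2 * n div e = d" using d pos by simp
  have nd: "2 * real n = real e * real d"
    using d by (metis of_nat_mult of_nat_numeral)
  have angle: "real (d * j) * pi / real n = 2 * real j * pi / real e" for j
  proof -
    have n': "real n = real e * real d / 2" using nd by simp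
    show ?thesis unfolding n' using pos by (simp add: field_simps)
  qed
  show ?thesis
  proof (cases "even d")
    case True
    then have "rotoref n (d * j) = rot e3 (2 * real j * pi / real e)" for j
      by (simp only: rotoref_even angle dvd_mult2)
    then show ?thesis
      using True pos by (simp add: Z_minus_subgroup_def quot img Z_rot_eq)
  next
    case False
    then have "even e" using d by (metis dvd_triv_left even_mult_iff)
    then obtain c where c: "e = 2 * c" by blast
    have "rotoref n (d * j) = rotoref c j" for j
    proof -
      have "2 * real j * pi / real e = real j * pi / real c" using c by simp
      with False show ?thesis
        unfolding rotoref_def angle by (simp add: power_mult)
    qed
    moreover have "Z_minus e = range (rotoref c)"
      using c pos by (simp add: Z_minus_eq)
    ultimately show ?thesis
      using False by (simp add: Z_minus_subgroup_def quot img)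
  qed
qed

lemma rotation_matrixD: "rotation_matrix A \<Longrightarrow> orthogonal_matrix A" "rotation_matrix A \<Longrightarrow> det A = 1"
  by (simp_all add: rotation_matrix_def)

lemma orthogonal_matrix_neg: "orthogonal_matrix (- A) = orthogonal_matrix (A :: real^3^3)"
  by (simp add: orthogonal_matrix_def transpose_neg matrix_neg_mult matrix_mult_neg)

lemma orthogonal_rotoref: "orthogonal_matrix (rotoref n k)"
  using rotation_matrixD(1)[OF rotation_matrix_rot_e3]
  by (cases "even k") (simp_all add: rotoref_even rotoref_odd orthogonal_matrix_neg)

lemma rotoref_multiple: "n > 0 \<Longrightarrow> rotoref n (2 * n * k) = mat 1"
  using rot_e3_period[of 0 k] by (simp add: rotoref_even rot_e3_0 mult.commute mult.left_commute)

lemma subgroup_Z_minus: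
  assumes "n > 0"
  shows "subgroup (Z_minus (2 * n)) O3"
proof (rule O3.subgroupI)
  show "Z_minus (2 * n) \<subseteq> carrier O3" "Z_minus (2 * n) \<noteq> {}"
    using assms by (auto simp: Z_minus_eq orthogonal_rotoref)
  show "a \<otimes>\<^bsub>O3\<^esub> b \<in> Z_minus (2 * n)" if "a \<in> Z_minus (2 * n)" "b \<in> Z_minus (2 * n)" for a b
    using assms that by (auto simp: Z_minus_eq rotoref_add)
  show "inv\<^bsub>O3\<^esub> a \<in> Z_minus (2 * n)" if a: "a \<in> Z_minus (2 * n)" for a
  proof -
    obtain k where k: "a = rotoref n k" using assms a by (auto simp: Z_minus_eq)
    have "(2 * n - 1) * k + k = 2 * n * k"
      using assms by (cases n) (simp_all add: algebra_simps)
    then have "rotoref n ((2 * n - 1) * k) ** a = mat 1"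
      using assms by (simp only: k rotoref_add rotoref_multiple)
    then have "inv\<^bsub>O3\<^esub> a = rotoref n ((2 * n - 1) * k)"
      by (intro O3.inv_equality) (simp_all add: k orthogonal_rotoref)
    then show ?thesis using assms by (simp add: Z_minus_eq)
  qed
qed

text \<open>
  Signs can be pulled out of products and inverses, so closure reduces to that of \<open>H\<close>.
\<close>

lemma subgroup_oplus_Z2c:
  assumes "subgroup H O3"
  shows "subgroup (oplus_Z2c H) O3"
proof (rule O3.subgroupI)
  have sub: "H \<subseteq> carrier O3" using assms by (rule subgroup.subset)
  then show "oplus_Z2c H \<subseteq> carrier O3"
    by (auto simp: oplus_Z2c_def orthogonal_matrix_neg)
  show "oplus_Z2c H \<noteq> {}"
    using subgroup.one_closed[OF assms] by (auto simp: oplus_Z2c_def)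
  have m: "a ** b \<in> H" if "a \<in> H" "b \<in> H" for a b
    using subgroup.m_closed[OF assms that] by simp
  show "a \<otimes>\<^bsub>O3\<^esub> b \<in> oplus_Z2c H" if "a \<in> oplus_Z2c H" "b \<in> oplus_Z2c H" for a b
    using that m by (auto simp: oplus_Z2c_def matrix_neg_mult matrix_mult_neg)
  have t: "transpose a \<in> H" if "a \<in> H" for a
    using subgroup.m_inv_closed[OF assms that] sub that by (auto simp: inv_O3)
  show "inv\<^bsub>O3\<^esub> a \<in> oplus_Z2c H" if "a \<in> oplus_Z2c H" for a
  proof -
    have "orthogonal_matrix a" using sub that by (auto simp: oplus_Z2c_def orthogonal_matrix_neg)
    then show ?thesis using that t by (auto simp: inv_O3 oplus_Z2c_def transpose_neg)
  qed
qed

text \<open>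
  The exponents of the powers of a generator that lie in a subgroup form such a set; it consists of the
  multiples of its least positive element, by division with remainder.
\<close>

lemma nat_add_subgroup_eq_multiples:
  fixes G :: "nat set"
  assumes N: "N \<in> G" "N > 0" and add: "\<And>a b. a \<in> G \<Longrightarrow> b \<in> G \<Longrightarrow> a + b \<in> G"
    and diff: "\<And>a b. a \<in> G \<Longrightarrow> b \<in> G \<Longrightarrow> a - b \<in> G"
  shows "\<exists>d>0. G = {k. d dvd k}"
proof -
  define d where "d = (LEAST k. k \<in> G \<and> k > 0)"
  have d: "d \<in> G" "d > 0"
    using LeastI[of "\<lambda>k. k \<in> G \<and> k > 0" N] N by (auto simp: d_def)
  have mult: "d * q \<in> G" for q
    using diff[OF d(1) d(1)] d(1) by (induction q) (auto intro: add)
  have "d dvd k" if "k \<in> G" for k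
  proof -
    have "k mod d \<in> G"
      using diff[OF that mult[of "k div d"]] by (simp add: minus_mult_div_eq_mod)
    moreover have "k mod d < d" using d by simp
    ultimately have "k mod d = 0"
      using not_less_Least[of "k mod d" "\<lambda>k. k \<in> G \<and> k > 0"] by (auto simp: d_def)
    then show ?thesis by auto
  qed
  then have "G = {k. d dvd k}" using mult by auto
  with d(2) show ?thesis by blast
qed

text \<open>
  The order \<open>e\<close> of the intersection is characterised by the rotations about \<open>e3\<close> that \<open>J\<close> contains.
  This is what allows \<open>e\<close> to be read off from the elements of \<open>J\<close>.
\<close>

lemma Z_minus_Int:
  assumes n: "n > 0" and J: "subgroup J O3" and neg: "\<And>A. A \<in> J \<Longrightarrow> - A \<in> J"
  obtains e where "e dvd 2 * n" and "Z_minus (2 * n) \<inter> J = Z_minus_subgroup n e"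
    and "\<And>e'. e' dvd 2 * n \<Longrightarrow> rot e3 (2 * pi / real e') \<in> J \<longleftrightarrow> e' dvd e"
proof -
  define G where "G = {k. rotoref n k \<in> J}"
  have mem: "rotoref n k \<in> J \<longleftrightarrow> rot e3 (real k * pi / real n) \<in> J" for k
    using neg[of "rot e3 (real k * pi / real n)"] neg[of "rotoref n k"]
    by (cases "even k") (auto simp: rotoref_even rotoref_odd)
  have m: "a ** b \<in> J" if "a \<in> J" "b \<in> J" for a b
    using subgroup.m_closed[OF J that] by simp
  have one: "mat 1 \<in> J" using subgroup.one_closed[OF J] by simp
  have "\<exists>d>0. G = {k. d dvd k}"
  proof (rule nat_add_subgroup_eq_multiples)
    show N: "2 * n \<in> G" "2 * n > 0"
      using n rotoref_multiple[of n 1] one by (simp_all add: G_def)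
    show "a + b \<in> G" if "a \<in> G" "b \<in> G" for a b
      using that m by (auto simp: G_def simp flip: rotoref_add)
    show "a - b \<in> G" if "a \<in> G" "b \<in> G" for a b
    proof (cases "b \<le> a")
      case True
      have "inv\<^bsub>O3\<^esub> rotoref n b \<in> J"
        using that J by (simp add: G_def subgroup.m_inv_closed)
      then have "rotoref n a ** transpose (rotoref n b) \<in> J"
        using that m by (simp add: G_def inv_O3 orthogonal_rotoref)
      moreover have "rotoref n a = rotoref n (a - b) ** rotoref n b"
        using True by (simp add: rotoref_add)
      ultimately show ?thesis
        using orthogonal_rotoref[of n b]
        by (simp add: G_def orthogonal_matrix_def flip: matrix_mul_assoc)
    next
      case False
      then show ?thesis
        using one by (simp add: G_def rotoref_even rot_e3_0)
    qed
  qed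
  then obtain d where d: "d > 0" "G = {k. d dvd k}" by blast
  have "2 * n \<in> G"
    using n rotoref_multiple[of n 1] one by (simp add: G_def)
  then obtain e where e: "2 * n = d * e" using d by auto
  then have e0: "e > 0" using n by (auto intro!: Nat.gr0I)
  have de: "2 * n div e = d" using e e0 by simp
  show thesis
  proof (rule that)
    show "e dvd 2 * n" using e by simp
    then show "Z_minus (2 * n) \<inter> J = Z_minus_subgroup n e"
      using n d by (auto simp: Z_minus_subgroup_eq Z_minus_eq de G_def)
    show "rot e3 (2 * pi / real e') \<in> J \<longleftrightarrow> e' dvd e" if e': "e' dvd 2 * n" for e'
    proof -
      obtain d' where d': "2 * n = e' * d'" using e' by blast
      then have pos: "e' > 0" "d' > 0" using n by (auto intro!: Nat.gr0I)
      have "2 * real n = real e' * real d'"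
        using d' by (metis of_nat_mult of_nat_numeral)
      then have n': "real n = real e' * real d' / 2" by simp
      have "2 * pi / real e' = real d' * pi / real n"
        unfolding n' using pos by (simp add: field_simps)
      then have "rot e3 (2 * pi / real e') \<in> J \<longleftrightarrow> d dvd d'"
        using mem d by (auto simp: G_def)
      also have "\<dots> \<longleftrightarrow> e' dvd e"
      proof -
        have eq: "d * e = e' * d'" using e d' by simp
        have "e = e' * q" if "d' = d * q" for q
          using eq d(1) by (simp add: that mult.left_commute)
        moreover have "d' = d * q" if "e = e' * q" for q
          using eq pos(1) by (simp add: that mult.left_commute)
        ultimately show ?thesis by (metis dvd_def)
      qed
      finally show ?thesis .
    qed
  qed
qed

lemma mem_conj_by:
  assumes "orthogonal_matrix g"
  shows "A \<in> conj_by g K \<longleftrightarrow> transpose g ** A ** g \<in> K"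
proof -
  have o: "transpose g ** g = mat 1" "g ** transpose g = mat 1"
    using assms by (simp_all add: orthogonal_matrix_def)
  have 1: "transpose g ** (g ** h ** transpose g) ** g = h" for h
    using o by (simp add: matrix_mul_assoc) (simp flip: matrix_mul_assoc)
  have 2: "A = g ** (transpose g ** A ** g) ** transpose g"
    using o by (simp add: matrix_mul_assoc) (simp flip: matrix_mul_assoc)
  show ?thesis
    unfolding conj_by_image using assms 1 2 by (auto simp: inv_O3)
qed

text \<open>
  Membership in the conjugate means that \<open>transpose g ** a ** g\<close> lies in \<open>K\<close>, and \<open>g ** transpose g\<close>
  cancels in products of such elements.
\<close>

lemma subgroup_conj_by:
  assumes K: "subgroup K O3" and g: "orthogonal_matrix g"
  shows "subgroup (conj_by g K) O3"
proof (rule O3.subgroupI)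
  have sub: "K \<subseteq> carrier O3" using K by (rule subgroup.subset)
  then show c: "conj_by g K \<subseteq> carrier O3"
    using g by (intro conj_by_subset) simp_all
  have o: "transpose g ** g = mat 1" "g ** transpose g = mat 1"
    using g by (simp_all add: orthogonal_matrix_def)
  show "conj_by g K \<noteq> {}"
    using subgroup.one_closed[OF K] by (auto simp: conj_by_def l_coset_def r_coset_def)
  show "a \<otimes>\<^bsub>O3\<^esub> b \<in> conj_by g K" if "a \<in> conj_by g K" "b \<in> conj_by g K" for a b
  proof -
    have "(transpose g ** a ** g) ** (transpose g ** b ** g) \<in> K"
      using that g subgroup.m_closed[OF K] by (simp add: mem_conj_by)
    moreover have "(transpose g ** a ** g) ** (transpose g ** b ** g)
        = transpose g ** a ** (g ** transpose g) ** b ** g"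
      by (simp add: matrix_mul_assoc)
    ultimately show ?thesis
      using g o by (simp add: mem_conj_by matrix_mul_assoc)
  qed
  show "inv\<^bsub>O3\<^esub> a \<in> conj_by g K" if a: "a \<in> conj_by g K" for a
  proof -
    have k: "transpose g ** a ** g \<in> K" using a g by (simp add: mem_conj_by)
    have "transpose (transpose g ** a ** g) \<in> K"
      using subgroup.m_inv_closed[OF K k] sub k by (auto simp: inv_O3)
    moreover have "orthogonal_matrix a" using a c by auto
    ultimately show ?thesis
      using g by (simp add: inv_O3 mem_conj_by matrix_transpose_mul matrix_mul_assoc)
  qed
qed

section \<open>Clips of \<open>Z_minus (2 * n)\<close> with a group containing the inversion\<close>

text \<open>
  Here \<open>M\<close> is the set of orders of elements of \<open>H\<close>.  The assumption \<open>orders\<close> says, through traces, that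
  every rotation in \<open>H\<close> has an order in \<open>M\<close>; it bounds the intersections from above.  The assumption
  \<open>axes\<close> says that every \<open>m \<in> M\<close> is the exact order of the rotations in \<open>H\<close> about some axis \<open>u\<close>.
  Moving \<open>u\<close> to \<open>e3\<close> then gives an intersection of order exactly \<open>m\<close> whenever \<open>m\<close> divides \<open>2 * n\<close>.
\<close>

theorem clips_Z_minus:
  assumes n: "n > 0" and H: "subgroup H O3" and rot: "\<And>A. A \<in> H \<Longrightarrow> rotation_matrix A"
    and dvd_closed: "\<And>m e. m \<in> M \<Longrightarrow> e dvd m \<Longrightarrow> e \<in> M"
    and orders: "\<And>A \<theta>. A \<in> H \<Longrightarrow> trace A = 1 + 2 * cos \<theta> \<Longrightarrow> \<exists>m\<in>M. cos (real m * \<theta>) = 1"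
    and axes: "\<And>m. m \<in> M \<Longrightarrow> \<exists>u. u \<noteq> 0 \<and> rot u (2 * pi / real m) \<in> H \<and>
        (\<forall>m'\<in>M. m dvd m' \<longrightarrow> rot u (2 * pi / real m') \<in> H \<longrightarrow> m' = m)"
  shows "conj_class (Z_minus (2 * n)) clips conj_class (oplus_Z2c H)
    = (\<lambda>e. conj_class (Z_minus_subgroup n e)) ` {e \<in> M. e dvd 2 * n}"
proof -
  have sub: "subgroup (conj_by g (oplus_Z2c H)) O3" if "orthogonal_matrix g" for g
    using subgroup_conj_by[OF subgroup_oplus_Z2c[OF H] that] .
  have neg: "- A \<in> conj_by g (oplus_Z2c H)"
    if "orthogonal_matrix g" "A \<in> conj_by g (oplus_Z2c H)" for g A
    using that by (auto simp: mem_conj_by oplus_Z2c_def matrix_neg_mult matrix_mult_neg)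
  have mem: "rot e3 \<theta> \<in> conj_by g (oplus_Z2c H) \<longleftrightarrow> transpose g ** rot e3 \<theta> ** g \<in> H"
    if "orthogonal_matrix g" for g \<theta>
  proof -
    let ?A = "transpose g ** rot e3 \<theta> ** g"
    have "det (transpose g ** g) = 1" using that by (simp add: orthogonal_matrix_def)
    then have "det ?A = 1"
      using rotation_matrixD(2)[OF rotation_matrix_rot_e3, of \<theta>] by (simp add: det_mul)
    then have "- ?A \<notin> H" using rot[of "- ?A"] by (auto simp: det_neg3 dest!: rotation_matrixD(2))
    then have "?A \<notin> uminus ` H" by (metis imageE minus_minus)
    then show ?thesis using that by (simp add: mem_conj_by oplus_Z2c_def)
  qed
  have order: "e \<in> M" if e: "A \<in> H" "trace A = 1 + 2 * cos (2 * pi / real e)" "e > 0" for A e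
  proof -
    obtain m where m: "m \<in> M" "cos (real m * (2 * pi / real e)) = 1"
      using orders e(1,2) by blast
    then obtain i :: int where "real m * (2 * pi / real e) = of_int i * 2 * pi"
      by (auto simp: cos_one_2pi_int)
    then have "real_of_int (int m) = real_of_int (i * int e)"
      using e(3) by (simp add: field_simps)
    then have "int e dvd int m" by (simp only: of_int_eq_iff dvd_triv_right)
    then show ?thesis using dvd_closed m(1) by simp
  qed
  have "{conj_class (Z_minus (2 * n) \<inter> conj_by g (oplus_Z2c H)) | g. g \<in> carrier O3}
    = (\<lambda>e. conj_class (Z_minus_subgroup n e)) ` {e \<in> M. e dvd 2 * n}"
  proof (intro equalityI subsetI)
    fix C assume "C \<in> {conj_class (Z_minus (2 * n) \<inter> conj_by g (oplus_Z2c H)) | g. g \<in> carrier O3}"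
    then obtain g where g: "orthogonal_matrix g"
      and C: "C = conj_class (Z_minus (2 * n) \<inter> conj_by g (oplus_Z2c H))" by auto
    obtain e where e: "e dvd 2 * n"
        "Z_minus (2 * n) \<inter> conj_by g (oplus_Z2c H) = Z_minus_subgroup n e"
        "rot e3 (2 * pi / real e) \<in> conj_by g (oplus_Z2c H)"
      using Z_minus_Int[OF n sub[OF g] neg[OF g]] by (metis dvd_refl)
    have "trace (transpose g ** rot e3 (2 * pi / real e) ** g) = 1 + 2 * cos (2 * pi / real e)"
      using trace_orthogonal_conj[of "transpose g"] g
      by (simp add: trace_rot_e3 orthogonal_matrix_transpose)
    moreover have "transpose g ** rot e3 (2 * pi / real e) ** g \<in> H"
      using e(3) mem[OF g] by simp
    moreover have "e > 0" using e(1) n by (auto intro!: Nat.gr0I)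
    ultimately have "e \<in> M" by (intro order)
    then show "C \<in> (\<lambda>e. conj_class (Z_minus_subgroup n e)) ` {e \<in> M. e dvd 2 * n}"
      using e C by auto
  next
    fix C assume "C \<in> (\<lambda>e. conj_class (Z_minus_subgroup n e)) ` {e \<in> M. e dvd 2 * n}"
    then obtain m where m: "m \<in> M" "m dvd 2 * n" and C: "C = conj_class (Z_minus_subgroup n m)"
      by auto
    obtain u where u: "u \<noteq> 0" "rot u (2 * pi / real m) \<in> H"
      "\<And>m'. m' \<in> M \<Longrightarrow> m dvd m' \<Longrightarrow> rot u (2 * pi / real m') \<in> H \<Longrightarrow> m' = m"
      using axes[OF m(1)] by blast
    obtain g where g: "rotation_matrix g" "\<And>\<theta>. g ** rot u \<theta> ** transpose g = rot e3 \<theta>"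
      using rotation_to_e3[OF u(1)] by blast
    have o: "orthogonal_matrix g" using g(1) by (rule rotation_matrixD)
    have "transpose g ** rot e3 \<theta> ** g = rot u \<theta>" for \<theta>
    proof -
      have "transpose g ** (g ** rot u \<theta> ** transpose g) ** g = rot u \<theta>"
        using o by (simp add: matrix_mul_assoc orthogonal_matrix_def)
                   (simp add: orthogonal_matrix_def flip: matrix_mul_assoc)
      then show ?thesis by (simp only: g(2))
    qed
    then have memu: "rot e3 \<theta> \<in> conj_by g (oplus_Z2c H) \<longleftrightarrow> rot u \<theta> \<in> H" for \<theta>
      using mem[OF o] by simp
    obtain e where e: "e dvd 2 * n"
        "Z_minus (2 * n) \<inter> conj_by g (oplus_Z2c H) = Z_minus_subgroup n e"
        "\<And>e'. e' dvd 2 * n \<Longrightarrow> rot u (2 * pi / real e') \<in> H \<longleftrightarrow> e' dvd e"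
      using Z_minus_Int[OF n sub[OF o] neg[OF o]] unfolding memu by blast
    have "e > 0" using e(1) n by (auto intro!: Nat.gr0I)
    have "m dvd e" using e(3)[OF m(2)] u(2) by simp
    moreover have ue: "rot u (2 * pi / real e) \<in> H" using e(3)[OF e(1)] by simp
    moreover have "e \<in> M"
      using order[OF ue trace_rot[OF u(1)] \<open>e > 0\<close>] .
    ultimately have "e = m" using u(3) by blast
    then show "C \<in> {conj_class (Z_minus (2 * n) \<inter> conj_by g (oplus_Z2c H)) | g. g \<in> carrier O3}"
      using C e(2) o by (auto intro!: exI[of _ g])
  qed
  then show ?thesis
    using clips_conj_class[OF subgroup_Z_minus[OF n] subgroup_oplus_Z2c[OF H]] by simp
qed

section \<open>Coset enumeration\<close>

text \<open>
  Left multiplication by a generator is injective on the finite set \<open>S\<close>, hence permutes it.  So \<open>S\<close> is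
  also invariant under inverses of generators, and therefore under the generated group, which is
  contained in \<open>S\<close> because \<open>\<one> \<in> S\<close>.
\<close>

lemma (in group) generate_subset_if_left_invariant:
  assumes "finite S" "S \<subseteq> carrier G" "\<one> \<in> S" "X \<subseteq> carrier G"
    and inv: "\<And>x s. x \<in> X \<Longrightarrow> s \<in> S \<Longrightarrow> x \<otimes> s \<in> S"
  shows "generate G X \<subseteq> S"
proof -
  have "\<forall>s\<in>S. h \<otimes> s \<in> S" if "h \<in> generate G X" for h
    using that
  proof (induction h rule: generate.induct)
    case one
    then show ?case using assms by auto
  next
    case (incl h)
    then show ?case using inv by blast
  next
    case (inv x)
    then have x: "x \<in> carrier G" using assms by blast
    have "inj_on ((\<otimes>) x) S"
      using inj_on_cmult[OF x] assms(2) by (rule inj_on_subset)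
    then have "(\<otimes>) x ` S = S"
      using assms(1) assms(5)[OF inv] by (intro endo_inj_surj) auto
    show ?case
    proof
      fix s assume "s \<in> S"
      then obtain s' where "s' \<in> S" "s = x \<otimes> s'" using \<open>(\<otimes>) x ` S = S\<close> by blast
      then show "inv x \<otimes> s \<in> S"
        using x assms(2) by (auto simp: m_assoc[symmetric])
    qed
  next
    case (eng h1 h2)
    then show ?case
      using assms by (auto simp: m_assoc generate_in_carrier subset_iff)
  qed
  then show ?thesis
    using assms(3,4) generate_in_carrier[OF assms(4)] by force
qed

lemma finite_products: "finite C \<Longrightarrow> finite T \<Longrightarrow> finite {c ** t | c t. c \<in> C \<and> t \<in> T}"
  by (rule finite_image_set2) simp_all

text \<open>
  The set \<open>T\<close> plays the part of a subgroup whose elements are known and \<open>C\<close> that of coset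
  representatives; \<open>step\<close> is the coset table of the generators.
\<close>

lemma generate_subset_cosets:
  assumes fin: "finite C" "finite T" and orth: "\<And>A. A \<in> C \<union> T \<union> X \<Longrightarrow> orthogonal_matrix A"
    and one: "mat 1 \<in> C" "mat 1 \<in> T"
    and T: "\<And>s t. s \<in> T \<Longrightarrow> t \<in> T \<Longrightarrow> s ** t \<in> T"
    and step: "\<And>x c. x \<in> X \<Longrightarrow> c \<in> C \<Longrightarrow> \<exists>c'\<in>C. \<exists>t\<in>T. x ** c = c' ** t"
  shows "generate O3 X \<subseteq> {c ** t | c t. c \<in> C \<and> t \<in> T}"
proof (rule O3.generate_subset_if_left_invariant)
  show "{c ** t | c t. c \<in> C \<and> t \<in> T} \<subseteq> carrier O3" "X \<subseteq> carrier O3"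
    using orth by (auto intro!: orthogonal_matrix_mul)
  show "\<one>\<^bsub>O3\<^esub> \<in> {c ** t | c t. c \<in> C \<and> t \<in> T}"
  proof -
    have "\<one>\<^bsub>O3\<^esub> = mat 1 ** (mat 1 :: real^3^3)" by simp
    with one show ?thesis by blast
  qed
  show "x \<otimes>\<^bsub>O3\<^esub> s \<in> {c ** t | c t. c \<in> C \<and> t \<in> T}"
    if x: "x \<in> X" and s: "s \<in> {c ** t | c t. c \<in> C \<and> t \<in> T}" for x s
  proof -
    obtain c t where c: "c \<in> C" "t \<in> T" "s = c ** t" using s by blast
    obtain c' t' where c': "c' \<in> C" "t' \<in> T" "x ** c = c' ** t'"
      using step[OF x c(1)] by blast
    have "x ** s = c' ** (t' ** t)" using c(3) c'(3) by (simp add: matrix_mul_assoc)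
    then show ?thesis unfolding O3_simps using T[OF c'(2) c(2)] c'(1) by blast
  qed
qed (use finite_products[OF fin] in simp)

section \<open>The tetrahedral group and the group of the cube\<close>

text \<open>
  The three even permutations of the coordinate axes, with signs \<open>a\<close>, \<open>b\<close>, \<open>c\<close> on the rows.
\<close>

abbreviation signed_perm0 :: "real \<Rightarrow> real \<Rightarrow> real \<Rightarrow> real^3^3" where
  "signed_perm0 a b c \<equiv> vector [vector [a, 0, 0], vector [0, b, 0], vector [0, 0, c]]"

abbreviation signed_perm1 :: "real \<Rightarrow> real \<Rightarrow> real \<Rightarrow> real^3^3" where
  "signed_perm1 a b c \<equiv> vector [vector [0, 0, a], vector [b, 0, 0], vector [0, c, 0]]"

abbreviation signed_perm2 :: "real \<Rightarrow> real \<Rightarrow> real \<Rightarrow> real^3^3" where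
  "signed_perm2 a b c \<equiv> vector [vector [0, a, 0], vector [0, 0, b], vector [c, 0, 0]]"

text \<open>
  Of the eight sign patterns, the four with product 1 are those of determinant 1.
\<close>

definition tetra_matrices :: "(real^3^3) set" where
  "tetra_matrices =
    (\<Union>(a, b, c)\<in>{(1, 1, 1), (1, - 1, - 1), (- 1, 1, - 1), (- 1, - 1, 1)}.
       {signed_perm0 a b c, signed_perm1 a b c, signed_perm2 a b c})"

lemma tetra_matrices_mult: "A \<in> tetra_matrices \<Longrightarrow> B \<in> tetra_matrices \<Longrightarrow> A ** B \<in> tetra_matrices"
  unfolding tetra_matrices_def
  by (elim UN_E; clarsimp; elim disjE; simp add: matrix3)

lemma finite_tetra_matrices: "finite tetra_matrices"
  by (simp add: tetra_matrices_def)

lemma one_tetra_matrices: "mat 1 \<in> tetra_matrices"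
  by (simp add: tetra_matrices_def matrix3)

lemma orthogonal_tetra_matrices: "A \<in> tetra_matrices \<Longrightarrow> orthogonal_matrix A"
  unfolding tetra_matrices_def
  by (rule orthogonal_matrixI) (auto simp: matrix3)

lemma trace_tetra_matrices: "A \<in> tetra_matrices \<Longrightarrow> trace A \<in> {3, - 1, 0}"
  unfolding tetra_matrices_def by (auto simp: matrix3)

lemma axis_eqs:
  "e1 = vector [1, 0, 0]" "e3 = vector [0, 0, 1]" "e1 + e2 + e3 = vector [1, 1, 1]"
  "e1 + e2 = vector [1, 1, 0]" "e1 + x *\<^sub>R e3 = vector [1, 0, x]"
  by (simp_all add: vec_eq_iff forall_3 axis_def)

lemma rot_e3_pi: "rot e3 pi = signed_perm0 (- 1) (- 1) 1"
  by (simp add: rot_e3)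

lemma rot_e3_pi_half: "rot e3 (pi / 2) = vector [vector [0, - 1, 0], vector [1, 0, 0], vector [0, 0, 1]]"
  by (simp add: rot_e3)

lemma rot_e1_pi: "rot e1 pi = signed_perm0 1 (- 1) (- 1)"
  unfolding axis_eqs by (subst rot_vector[of 1]) (simp_all)

lemma rot_diagonal:
  "rot (e1 + e2 + e3) (2 * pi / 3) = signed_perm1 1 1 1"
  unfolding axis_eqs(3)
  by (subst rot_vector[of "sqrt 3"]) (simp_all add: cos_120 sin_120 matrix3_eq_iff)

lemma generators_in_tetra_matrices:
  "rot e3 pi \<in> tetra_matrices" "rot e1 pi \<in> tetra_matrices"
  "rot (e1 + e2 + e3) (2 * pi / 3) \<in> tetra_matrices"
  by (simp_all add: tetra_matrices_def rot_e3_pi rot_e1_pi rot_diagonal matrix3)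

lemma tetra_group_subset: "tetra_group \<subseteq> tetra_matrices"
proof -
  have "tetra_group \<subseteq> {c ** t | c t. c \<in> {mat 1} \<and> t \<in> tetra_matrices}"
    unfolding tetra_group_def
    by (rule generate_subset_cosets)
       (auto simp: orthogonal_tetra_matrices tetra_matrices_mult one_tetra_matrices
          finite_tetra_matrices generators_in_tetra_matrices orthogonal_matrix_id)
  then show ?thesis by auto
qed

text \<open>
  A quarter turn about \<open>e3\<close> normalises the tetrahedral matrices, and its square is one of them.
\<close>

lemma octa_group_subset:
  "octa_group \<subseteq> {c ** t | c t. c \<in> {mat 1, rot e3 (pi / 2)} \<and> t \<in> tetra_matrices}"
  unfolding octa_group_def
proof (rule generate_subset_cosets)
  let ?q = "rot e3 (pi / 2)"
  show "\<exists>c'\<in>{mat 1, ?q}. \<exists>t\<in>tetra_matrices. x ** c = c' ** t"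
    if "x \<in> {?q, rot e1 pi, rot (e1 + e2 + e3) (2 * pi / 3)}" "c \<in> {mat 1, ?q}" for x c
  proof -
    have "?q ** mat 1 = ?q ** mat 1" "?q ** ?q = mat 1 ** rot e3 pi"
      by (simp_all add: rot_e3_add)
    moreover have "rot e1 pi ** mat 1 = mat 1 ** rot e1 pi"
      "rot e1 pi ** ?q = ?q ** signed_perm0 (- 1) 1 (- 1)"
      by (simp_all add: rot_e1_pi rot_e3_pi_half matrix3)
    moreover have "rot (e1 + e2 + e3) (2 * pi / 3) ** mat 1 = mat 1 ** rot (e1 + e2 + e3) (2 * pi / 3)"
      "rot (e1 + e2 + e3) (2 * pi / 3) ** ?q = ?q ** signed_perm2 (- 1) (- 1) 1"
      by (simp_all add: rot_diagonal rot_e3_pi_half matrix3)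
    moreover have "signed_perm0 (- 1) 1 (- 1) \<in> tetra_matrices"
       "signed_perm2 (- 1) (- 1) 1 \<in> tetra_matrices"
      by (simp_all add: tetra_matrices_def matrix3)
    ultimately show ?thesis
      using that generators_in_tetra_matrices one_tetra_matrices by blast
  qed
qed (auto simp: orthogonal_tetra_matrices tetra_matrices_mult one_tetra_matrices
    finite_tetra_matrices generators_in_tetra_matrices orthogonal_matrix_id
    rotation_matrixD(1) rotation_matrix_rot_e3)

text \<open>
  In the second coset the underlying permutation is a transposition, with exactly one nonzero
  diagonal entry.
\<close>

lemma trace_octa_group:
  assumes "A \<in> octa_group" shows "trace A \<in> {3, - 1, 0, 1}"
proof -
  have "trace (rot e3 (pi / 2) ** t) \<in> {1, - 1}" if "t \<in> tetra_matrices" for t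
    using that unfolding tetra_matrices_def rot_e3_pi_half by (auto simp: matrix3)
  with assms octa_group_subset trace_tetra_matrices show ?thesis by fastforce
qed

text \<open>
  All entries of elements are integers; this one tells the edge axes apart from axes of order 4.
\<close>

lemma octa_group_entry:
  assumes "A \<in> octa_group" shows "A $ 1 $ 1 \<in> {0, 1, - 1}"
proof -
  have "t $ 1 $ 1 \<in> {0, 1, - 1}" "(rot e3 (pi / 2) ** t) $ 1 $ 1 \<in> {0, 1, - 1}"
    if "t \<in> tetra_matrices" for t
    using that unfolding tetra_matrices_def rot_e3_pi_half by (auto simp: matrix3)
  with assms octa_group_subset show ?thesis by fastforce
qed

section \<open>The icosahedral group\<close>

definition golden :: real where "golden = (1 + sqrt 5) / 2"

lemma golden_square: "golden * golden = golden + 1"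
  by (simp add: golden_def field_simps)

lemma golden_pos: "golden > 1"
  by (simp add: golden_def)

lemma cos_5_times: "cos (5 * x) = 16 * cos x ^ 5 - 20 * cos x ^ 3 + 5 * cos (x::real)"
proof -
  have s2: "sin (2 * x) = 2 * sin x * cos x" and c2: "cos (2 * x) = 2 * (cos x)\<^sup>2 - 1"
    by (rule sin_double cos_double_cos)+
  have "sin (3 * x) = sin (2 * x + x)" by simp
  also have "\<dots> = 2 * sin x * cos x * cos x + (2 * (cos x)\<^sup>2 - 1) * sin x"
    by (simp only: sin_add s2 c2)
  finally have s3: "sin (3 * x) = sin x * (4 * (cos x)\<^sup>2 - 1)"
    by (simp add: algebra_simps power2_eq_square)
  have "cos (5 * x) = cos (3 * x + 2 * x)" by simp
  also have "\<dots> = (4 * cos x ^ 3 - 3 * cos x) * (2 * (cos x)\<^sup>2 - 1)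
      - sin x * (4 * (cos x)\<^sup>2 - 1) * (2 * sin x * cos x)"
    by (simp only: cos_add cos_treble_cos s3 c2 s2)
  also have "\<dots> = (4 * cos x ^ 3 - 3 * cos x) * (2 * (cos x)\<^sup>2 - 1)
      - (1 - (cos x)\<^sup>2) * (4 * (cos x)\<^sup>2 - 1) * (2 * cos x)"
    unfolding sin_squared_eq[symmetric] by (simp add: power2_eq_square)
  also have "\<dots> = 16 * cos x ^ 5 - 20 * cos x ^ 3 + 5 * cos x"
    by (simp add: algebra_simps eval_nat_numeral)
  finally show ?thesis .
qed

text \<open>
  The factorisation of the fifth Chebyshev polynomial minus 1; the quadratic factor has the roots
  \<open>(golden - 1) / 2\<close> and \<open>- golden / 2\<close>, the cosines of the nontrivial rotations of order 5.
\<close>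

lemma cos_5_times_eq_1_iff:
  "cos (5 * x) = 1 \<longleftrightarrow> cos x = 1 \<or> 4 * (cos x)\<^sup>2 + 2 * cos (x::real) = 1"
proof -
  have "cos (5 * x) - 1 = (cos x - 1) * (4 * (cos x)\<^sup>2 + 2 * cos x - 1)\<^sup>2"
    unfolding cos_5_times by (simp add: algebra_simps eval_nat_numeral)
  then show ?thesis by auto
qed

lemma cos_2pi_5: "cos (2 * pi / 5) = (golden - 1) / 2"
proof -
  let ?c = "cos (2 * pi / 5)"
  have pos: "?c > 0" by (rule cos_gt_zero) simp_all
  have "?c < cos 0" by (rule cos_monotone_0_pi) simp_all
  moreover have "cos (5 * (2 * pi / 5)) = 1" by simp
  ultimately have "4 * ?c\<^sup>2 + 2 * ?c = 1"
    unfolding cos_5_times_eq_1_iff by simp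
  then have "(2 * ?c - (golden - 1)) * (2 * ?c + golden) = 0"
    using golden_square by (simp add: algebra_simps power2_eq_square)
  moreover have "2 * ?c + golden > 0" using pos golden_pos by simp
  ultimately show ?thesis by simp
qed

lemma sin_2pi_5: "sin (2 * pi / 5) = sqrt (golden + 2) / 2"
proof -
  have pos: "sin (2 * pi / 5) > 0" by (rule sin_gt_zero) simp_all
  have "(2 * sin (2 * pi / 5))\<^sup>2 = golden + 2"
    using golden_square
    unfolding power_mult_distrib sin_squared_eq cos_2pi_5
    by (simp add: power2_eq_square field_simps)
  then have "sqrt (golden + 2) = 2 * sin (2 * pi / 5)"
    using pos by (intro real_sqrt_unique) simp_all
  then show ?thesis by simp
qed

text \<open>
  The generating rotation of order 5 and its square.  The remaining powers are the transposes.
\<close>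

definition five_fold :: "real^3^3" where
  "five_fold = vector
     [vector [1 / 2, - golden / 2, (golden - 1) / 2],
      vector [golden / 2, (golden - 1) / 2, - 1 / 2],
      vector [(golden - 1) / 2, 1 / 2, golden / 2]]"

definition five_fold2 :: "real^3^3" where
  "five_fold2 = vector
     [vector [(1 - golden) / 2, - 1 / 2, golden / 2],
      vector [1 / 2, - golden / 2, (1 - golden) / 2],
      vector [golden / 2, (golden - 1) / 2, 1 / 2]]"

text \<open>
  The axis has length \<open>sqrt (golden + 2)\<close>, which cancels the root in the sine of \<open>2 * pi / 5\<close>.
\<close>

lemma rot_icosa_axis:
  "rot (e1 + golden *\<^sub>R e3) (2 * pi / 5) = five_fold"
proof -
  let ?s = "sqrt (golden + 2)"
  have s: "?s > 0" "?s\<^sup>2 = 1\<^sup>2 + 0\<^sup>2 + golden\<^sup>2"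
    using golden_pos golden_square by (simp_all add: power2_eq_square)
  have sc: "(1 - cos (2 * pi / 5)) / ?s\<^sup>2 = (2 - golden) / 2" "sin (2 * pi / 5) / ?s = 1 / 2"
    unfolding cos_2pi_5 sin_2pi_5 using golden_pos golden_square
    by (simp_all add: field_simps)
  show ?thesis
    unfolding five_fold_def axis_eqs(5) rot_vector[OF s] sc unfolding cos_2pi_5 using golden_square
    by (simp add: matrix3_eq_iff field_simps power2_eq_square)
qed

text \<open>
  The tetrahedral group has index 5 in the icosahedral group, and the powers of the rotation of
  order 5 represent the five cosets: the icosahedral group permutes the five cubes inscribed in the
  dodecahedron, the tetrahedral group fixes one of them, and the rotation of order 5 permutes them
  cyclically.
\<close>

lemma icosa_group_subset:
  "icosa_group \<subseteq> {c ** t | c t.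
    c \<in> {mat 1, five_fold, five_fold2, transpose five_fold2, transpose five_fold} \<and> t \<in> tetra_matrices}"
  (is "_ \<subseteq> {_ | c t. c \<in> ?C \<and> _}")
  unfolding icosa_group_def golden_def[symmetric] rot_icosa_axis
proof (rule generate_subset_cosets)
  show "\<exists>c'\<in>?C. \<exists>t\<in>tetra_matrices. x ** c = c' ** t"
    if "x \<in> {rot e3 pi, rot (e1 + e2 + e3) (2 * pi / 3), five_fold}" "c \<in> ?C" for x c
  proof -
    let ?F = five_fold and ?G = five_fold2 and ?z = "rot e3 pi" and ?p = "rot (e1 + e2 + e3) (2 * pi / 3)"
    have "?F ** mat 1 = ?F ** mat 1" "?F ** transpose ?F = mat 1 ** mat 1"
      "?F ** ?F = ?G ** mat 1" "?F ** ?G = transpose ?G ** mat 1" "?F ** transpose ?G = transpose ?F ** mat 1"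
      using golden_square by (simp_all add: five_fold_def five_fold2_def matrix3 field_simps)
    moreover have "?z ** mat 1 = mat 1 ** signed_perm0 (- 1) (- 1) 1"
      "?z ** ?F = ?G ** signed_perm1 1 1 1"
      "?z ** ?G = ?F ** signed_perm2 1 1 1"
      "?z ** transpose ?G = transpose ?F ** signed_perm2 (- 1) (- 1) 1"
      "?z ** transpose ?F = transpose ?G ** signed_perm1 1 (- 1) (- 1)"
      by (simp_all add: rot_e3_pi five_fold_def five_fold2_def matrix3 diff_divide_distrib)
    moreover have "?p ** mat 1 = mat 1 ** signed_perm1 1 1 1"
      "?p ** ?F = transpose ?F ** signed_perm2 1 1 1"
      "?p ** ?G = ?G ** signed_perm2 (- 1) (- 1) 1"
      "?p ** transpose ?G = ?F ** signed_perm1 1 (- 1) (- 1)"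
      "?p ** transpose ?F = transpose ?G ** signed_perm0 (- 1) (- 1) 1"
      by (simp_all add: rot_diagonal five_fold_def five_fold2_def matrix3 diff_divide_distrib)
    moreover have "signed_perm0 (- 1) (- 1) 1 \<in> tetra_matrices"
      "signed_perm1 1 1 1 \<in> tetra_matrices" "signed_perm1 1 (- 1) (- 1) \<in> tetra_matrices"
      "signed_perm2 1 1 1 \<in> tetra_matrices" "signed_perm2 (- 1) (- 1) 1 \<in> tetra_matrices"
      by (simp_all add: tetra_matrices_def)
    ultimately show ?thesis
      using that one_tetra_matrices by (elim insertE emptyE) blast+
  qed
  have "orthogonal_matrix five_fold" "orthogonal_matrix five_fold2"
    using golden_square
    by (auto intro!: orthogonal_matrixI simp: five_fold_def five_fold2_def matrix3 field_simps)
  then show "orthogonal_matrix A"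
    if "A \<in> ?C \<union> tetra_matrices \<union> {rot e3 pi, rot (e1 + e2 + e3) (2 * pi / 3), five_fold}" for A
    using that orthogonal_tetra_matrices generators_in_tetra_matrices
    by (auto simp: orthogonal_matrix_id orthogonal_matrix_transpose)
qed (auto simp: tetra_matrices_mult one_tetra_matrices finite_tetra_matrices)

lemma trace_five_fold_coset:
  "t \<in> tetra_matrices \<Longrightarrow> c \<in> {five_fold, five_fold2, transpose five_fold2, transpose five_fold} \<Longrightarrow>
    trace (c ** t) \<in> {0, - 1, golden, 1 - golden}"
  unfolding tetra_matrices_def
  by (elim UN_E insertE emptyE; clarsimp; elim disjE;
      simp add: five_fold_def five_fold2_def matrix3 diff_divide_distrib)

lemma trace_icosa_group:
  assumes "A \<in> icosa_group"
  shows "trace A \<in> {3, - 1, 0, golden, 1 - golden}"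
proof -
  obtain c t where t: "t \<in> tetra_matrices" and A: "A = c ** t"
    and c: "c = mat 1 \<or> c \<in> {five_fold, five_fold2, transpose five_fold2, transpose five_fold}"
    using assms icosa_group_subset by blast
  from c show ?thesis
  proof
    assume "c = mat 1"
    then show ?thesis using trace_tetra_matrices[OF t] by (auto simp: A)
  next
    assume "c \<in> {five_fold, five_fold2, transpose five_fold2, transpose five_fold}"
    from trace_five_fold_coset[OF t this] show ?thesis by (auto simp: A)
  qed
qed

section \<open>Orders of rotations and symmetry axes\<close>

lemma generate_rotations:
  assumes "\<And>x. x \<in> X \<Longrightarrow> rotation_matrix x"
  shows "subgroup (generate O3 X) O3" and "A \<in> generate O3 X \<Longrightarrow> rotation_matrix A"
proof -
  have "X \<subseteq> carrier O3"
    using rotation_matrixD(1)[OF assms] by auto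
  then show "subgroup (generate O3 X) O3" by (rule O3.generate_is_subgroup)
  have "subgroup {A. rotation_matrix A} O3"
    by (rule O3.subgroupI)
       (auto simp: rotation_matrix_def inv_O3 orthogonal_matrix_mul det_mul orthogonal_matrix_transpose
          intro: exI[of _ "mat 1"] orthogonal_matrix_id)
  then have "generate O3 X \<subseteq> {A. rotation_matrix A}"
    using assms by (intro O3.generate_subgroup_incl) auto
  then show "A \<in> generate O3 X \<Longrightarrow> rotation_matrix A" by blast
qed

lemma axis_nonzero:
  "e1 \<noteq> 0" "e3 \<noteq> 0" "e1 + e2 \<noteq> 0" "e1 + e2 + e3 \<noteq> 0" "e1 + x *\<^sub>R e3 \<noteq> 0"
  unfolding axis_eqs by (simp_all add: vec_eq_iff forall_3)

lemma tetra_group_rotations: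
  "subgroup tetra_group O3" "A \<in> tetra_group \<Longrightarrow> rotation_matrix A"
  unfolding tetra_group_def
  by (rule generate_rotations, auto simp: rotation_matrix_rot axis_nonzero)+

lemma octa_group_rotations:
  "subgroup octa_group O3" "A \<in> octa_group \<Longrightarrow> rotation_matrix A"
  unfolding octa_group_def
  by (rule generate_rotations, auto simp: rotation_matrix_rot axis_nonzero)+

lemma icosa_group_rotations:
  "subgroup icosa_group O3" "A \<in> icosa_group \<Longrightarrow> rotation_matrix A"
  unfolding icosa_group_def
  by (rule generate_rotations, auto simp: rotation_matrix_rot axis_nonzero)+

text \<open>
  The moment curve \<open>(1, t, t\<^sup>2)\<close> meets the fixed space of a matrix other than the identity in finitely
  many points, as each such point gives a root of a nonzero quadratic polynomial.  Finitely many
  matrices therefore leave some point of the curve that none of them fixes.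
\<close>

lemma exists_generic_axis:
  fixes H :: "(real^3^3) set"
  assumes "finite H"
  shows "\<exists>u. u \<noteq> 0 \<and> (\<forall>A\<in>H. A *v u = u \<longrightarrow> A = mat 1)"
proof -
  define u :: "real \<Rightarrow> real^3" where "u t = vector [1, t, t\<^sup>2]" for t
  have fin: "finite {t. A *v u t = u t}" if A: "A \<noteq> mat 1" for A
  proof -
    define B where "B = A - mat 1"
    from A have "B \<noteq> 0" by (simp add: B_def)
    then obtain i where i: "B $ i \<noteq> 0" by (auto simp: vec_eq_iff)
    define p where "p = [:B $ i $ 1, B $ i $ 2, B $ i $ 3:]"
    have "p \<noteq> 0" using i by (auto simp: p_def vec_eq_iff forall_3)
    moreover have "poly p t = 0" if "A *v u t = u t" for t
    proof -
      have "B *v u t = 0" using that by (simp add: B_def matrix_vector_mult_diff_rdistrib)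
      then have "(B *v u t) $ i = 0" by simp
      then show ?thesis
        by (simp add: p_def u_def matrix_vector_mult_def sum_3 power2_eq_square algebra_simps)
    qed
    ultimately show ?thesis
      by (intro finite_subset[OF _ poly_roots_finite[of p]]) auto
  qed
  have "finite (\<Union>A\<in>H - {mat 1}. {t. A *v u t = u t})" using assms fin by blast
  then obtain t where t: "t \<notin> (\<Union>A\<in>H - {mat 1}. {t. A *v u t = u t})"
    using ex_new_if_finite infinite_UNIV_char_0 by blast
  have "u t \<noteq> 0" by (simp add: u_def vec_eq_iff forall_3)
  with t show ?thesis by blast
qed

text \<open>
  Every rotation about the axis \<open>u\<close> fixes \<open>u\<close>, so for a generic \<open>u\<close> only the identity remains.
\<close>

lemma exists_trivial_axis:
  assumes fin: "finite H" and one: "mat 1 \<in> H" and pos: "\<And>m. m \<in> M \<Longrightarrow> m > 0"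
  shows "\<exists>u. u \<noteq> 0 \<and> rot u (2 * pi / real 1) \<in> H \<and>
    (\<forall>m'\<in>M. 1 dvd m' \<longrightarrow> rot u (2 * pi / real m') \<in> H \<longrightarrow> m' = 1)"
proof -
  obtain u where u: "u \<noteq> 0" "\<And>A. A \<in> H \<Longrightarrow> A *v u = u \<Longrightarrow> A = mat 1"
    using exists_generic_axis[OF fin] by blast
  have fixed: "rot u \<theta> *v u = u" for \<theta>
  proof -
    have "(sgn u \<bullet> u) *\<^sub>R sgn u = u"
      using u(1) by (simp add: sgn_div_norm power2_norm_eq_inner[symmetric] power2_eq_square field_simps)
    moreover have "cross3 (sgn u) u = 0"
      by (simp add: sgn_div_norm cross_mult_left cross_refl)
    ultimately show ?thesis
      by (simp add: rot_mult_vec scaleR_left_diff_distrib flip: scaleR_scaleR)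
  qed
  have full: "rot u (2 * pi) = mat 1"
    by (simp add: matrix_eq rot_mult_vec)
  have "m' = 1" if m: "m' \<in> M" "rot u (2 * pi / real m') \<in> H" for m'
  proof -
    have "rot u (2 * pi / real m') = mat 1" using u(2)[OF m(2) fixed] .
    then have "cos (2 * pi / real m') = 1"
      using trace_rot[OF u(1), of "2 * pi / real m'"] by (simp add: trace_I)
    then obtain i :: int where "2 * pi / real m' = of_int i * 2 * pi"
      by (auto simp: cos_one_2pi_int)
    then have "of_int i * real m' = 1" using pos[OF m(1)] by (simp add: field_simps)
    then have "i * int m' = 1" by (metis of_int_1 of_int_eq_iff of_int_mult of_int_of_nat_eq)
    then show ?thesis by (metis int_dvd_int_iff dvd_triv_right nat_dvd_1_iff_1 of_nat_1)
  qed
  then show ?thesis using u(1) one full by auto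
qed

lemma finite_tetra_group: "finite tetra_group"
  using tetra_group_subset finite_tetra_matrices by (rule finite_subset)

lemma finite_octa_group: "finite octa_group"
  by (rule finite_subset[OF octa_group_subset])
     (simp add: finite_products finite_tetra_matrices del: insert_iff)

lemma finite_icosa_group: "finite icosa_group"
  by (rule finite_subset[OF icosa_group_subset])
     (simp add: finite_products finite_tetra_matrices del: insert_iff)

text \<open>
  The possible traces \<open>1 + 2 * cos \<theta>\<close>, with the order of the rotation in each case.
\<close>

lemma cos_multiple_eq_1_of_trace:
  shows "1 + 2 * cos \<theta> = 3 \<Longrightarrow> cos (real 1 * \<theta>) = 1"
    and "1 + 2 * cos \<theta> = - 1 \<Longrightarrow> cos (real 2 * \<theta>) = 1"
    and "1 + 2 * cos \<theta> = 0 \<Longrightarrow> cos (real 3 * \<theta>) = 1"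
    and "1 + 2 * cos \<theta> = 1 \<Longrightarrow> cos (real 4 * \<theta>) = 1"
    and "1 + 2 * cos \<theta> \<in> {golden, 1 - golden} \<Longrightarrow> cos (real 5 * \<theta>) = 1"
proof -
  show "1 + 2 * cos \<theta> = 3 \<Longrightarrow> cos (real 1 * \<theta>) = 1" by simp
  show "cos (real 2 * \<theta>) = 1" if "1 + 2 * cos \<theta> = - 1"
  proof -
    have "cos \<theta> = - 1" using that by simp
    then show ?thesis using cos_double_cos[of \<theta>] by simp
  qed
  show "cos (real 3 * \<theta>) = 1" if "1 + 2 * cos \<theta> = 0"
  proof -
    have "cos \<theta> = - 1 / 2" using that by simp
    then show ?thesis using cos_treble_cos[of \<theta>] by (simp add: power3_eq_cube)
  qed
  show "cos (real 4 * \<theta>) = 1" if "1 + 2 * cos \<theta> = 1"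
  proof -
    have "cos (2 * \<theta>) = - 1" using that cos_double_cos[of \<theta>] by simp
    then show ?thesis using cos_double_cos[of "2 * \<theta>"] by simp
  qed
  show "cos (real 5 * \<theta>) = 1" if "1 + 2 * cos \<theta> \<in> {golden, 1 - golden}"
  proof -
    have "cos \<theta> = (golden - 1) / 2 \<or> cos \<theta> = - golden / 2" using that by auto
    then have "4 * (cos \<theta>)\<^sup>2 + 2 * cos \<theta> = 1"
    proof
      assume c: "cos \<theta> = (golden - 1) / 2"
      show ?thesis unfolding c using golden_square by (simp add: power2_eq_square field_simps)
    next
      assume c: "cos \<theta> = - golden / 2"
      show ?thesis unfolding c using golden_square by (simp add: power2_eq_square field_simps)
    qed
    then show ?thesis using cos_5_times_eq_1_iff[of \<theta>] by simp
  qed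
qed

lemma generators_in_groups:
  "rot e3 pi \<in> tetra_group" "rot (e1 + e2 + e3) (2 * pi / 3) \<in> tetra_group"
  "rot e3 pi \<in> icosa_group" "rot (e1 + e2 + e3) (2 * pi / 3) \<in> icosa_group"
  "rot (e1 + golden *\<^sub>R e3) (2 * pi / 5) \<in> icosa_group"
  "rot e3 (pi / 2) \<in> octa_group" "rot (e1 + e2 + e3) (2 * pi / 3) \<in> octa_group"
  by (simp_all add: tetra_group_def icosa_group_def octa_group_def golden_def generate.incl)

text \<open>
  The axis \<open>e1 + e2\<close> passes through midpoints of opposite edges of the cube.  A quarter turn about it
  has the entry \<open>1 / 2\<close>, so it is no symmetry of the cube.
\<close>

lemma octa_edge_axis:
  "rot (e1 + e2) pi \<in> octa_group" "rot (e1 + e2) (pi / 2) \<notin> octa_group"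
proof -
  have "rot e3 (pi / 2) \<otimes>\<^bsub>O3\<^esub> rot e1 pi \<in> octa_group"
    unfolding octa_group_def by (intro generate.eng generate.incl) simp_all
  moreover have "rot (e1 + e2) pi = rot e3 (pi / 2) ** rot e1 pi"
    unfolding axis_eqs(4) rot_e3_pi_half rot_e1_pi
    by (subst rot_vector[of "sqrt 2"]) (simp_all add: matrix3)
  ultimately show "rot (e1 + e2) pi \<in> octa_group" by simp
  have "rot (e1 + e2) (pi / 2) $ 1 $ 1 = 1 / 2"
    unfolding axis_eqs(4) by (subst rot_vector[of "sqrt 2"]) simp_all
  then show "rot (e1 + e2) (pi / 2) \<notin> octa_group"
    using octa_group_entry by fastforce
qed

lemma small_divisors:
  assumes "e dvd m" "(m::nat) \<in> {1, 2, 3, 4, 5}"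
  shows "e = 1 \<or> e = m \<or> (m = 4 \<and> e = 2)"
proof -
  have "e \<le> 5" using assms dvd_imp_le[OF assms(1)] by auto
  then have "e \<in> {0, 1, 2, 3, 4, 5}" by auto
  then show ?thesis using assms by auto
qed

section \<open>The three clips\<close>

lemma clips_tetra:
  assumes n: "n > 0"
  shows "conj_class (Z_minus (2 * n)) clips conj_class (oplus_Z2c tetra_group)
    = (\<lambda>e. conj_class (Z_minus_subgroup n e)) ` {e \<in> {1, 2, 3}. e dvd 2 * n}"
proof (rule clips_Z_minus[OF n tetra_group_rotations])
  show "e \<in> {1, 2, 3}" if "m \<in> {1, 2, 3}" "e dvd m" for m e :: nat
    using small_divisors[of e m] that by auto
  show "\<exists>m\<in>{1, 2, 3}. cos (real m * \<theta>) = 1"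
    if "A \<in> tetra_group" "trace A = 1 + 2 * cos \<theta>" for A \<theta>
  proof -
    have "1 + 2 * cos \<theta> \<in> {3, - 1, 0}"
      using trace_tetra_matrices[of A] tetra_group_subset that by auto
    then show ?thesis using cos_multiple_eq_1_of_trace(1-3)[of \<theta>] by blast
  qed
  show "\<exists>u. u \<noteq> 0 \<and> rot u (2 * pi / real m) \<in> tetra_group \<and>
      (\<forall>m'\<in>{1, 2, 3}. m dvd m' \<longrightarrow> rot u (2 * pi / real m') \<in> tetra_group \<longrightarrow> m' = m)"
    if m: "m \<in> {1, 2, 3}" for m :: nat
  proof -
    consider "m = 1" | "m = 2" | "m = 3" using m by blast
    then show ?thesis
    proof cases
      case 1
      show ?thesis unfolding 1
        using subgroup.one_closed[OF tetra_group_rotations(1)]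
        by (intro exists_trivial_axis finite_tetra_group) auto
    next
      case 2
      then show ?thesis by (intro exI[of _ e3]) (simp add: axis_nonzero generators_in_groups)
    next
      case 3
      then show ?thesis by (intro exI[of _ "e1 + e2 + e3"]) (simp add: axis_nonzero generators_in_groups)
    qed
  qed
qed simp_all

lemma clips_icosa:
  assumes n: "n > 0"
  shows "conj_class (Z_minus (2 * n)) clips conj_class (oplus_Z2c icosa_group)
    = (\<lambda>e. conj_class (Z_minus_subgroup n e)) ` {e \<in> {1, 2, 3, 5}. e dvd 2 * n}"
proof (rule clips_Z_minus[OF n icosa_group_rotations])
  show "e \<in> {1, 2, 3, 5}" if "m \<in> {1, 2, 3, 5}" "e dvd m" for m e :: nat
    using small_divisors[of e m] that by auto
  show "\<exists>m\<in>{1, 2, 3, 5}. cos (real m * \<theta>) = 1"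
    if "A \<in> icosa_group" "trace A = 1 + 2 * cos \<theta>" for A \<theta>
  proof -
    have "1 + 2 * cos \<theta> \<in> {3, - 1, 0} \<or> 1 + 2 * cos \<theta> \<in> {golden, 1 - golden}"
      using trace_icosa_group[OF that(1)] that(2) by auto
    then show ?thesis using cos_multiple_eq_1_of_trace(1-3,5)[of \<theta>] by blast
  qed
  show "\<exists>u. u \<noteq> 0 \<and> rot u (2 * pi / real m) \<in> icosa_group \<and>
      (\<forall>m'\<in>{1, 2, 3, 5}. m dvd m' \<longrightarrow> rot u (2 * pi / real m') \<in> icosa_group \<longrightarrow> m' = m)"
    if m: "m \<in> {1, 2, 3, 5}" for m :: nat
  proof -
    consider "m = 1" | "m = 2" | "m = 3" | "m = 5" using m by blast
    then show ?thesis
    proof cases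
      case 1
      show ?thesis unfolding 1
        using subgroup.one_closed[OF icosa_group_rotations(1)]
        by (intro exists_trivial_axis finite_icosa_group) auto
    next
      case 2
      then show ?thesis by (intro exI[of _ e3]) (simp add: axis_nonzero generators_in_groups)
    next
      case 3
      then show ?thesis by (intro exI[of _ "e1 + e2 + e3"]) (simp add: axis_nonzero generators_in_groups)
    next
      case 4
      then show ?thesis by (intro exI[of _ "e1 + golden *\<^sub>R e3"]) (simp add: axis_nonzero generators_in_groups)
    qed
  qed
qed simp_all

lemma clips_octa:
  assumes n: "n > 0"
  shows "conj_class (Z_minus (2 * n)) clips conj_class (oplus_Z2c octa_group)
    = (\<lambda>e. conj_class (Z_minus_subgroup n e)) ` {e \<in> {1, 2, 3, 4}. e dvd 2 * n}"
proof (rule clips_Z_minus[OF n octa_group_rotations])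
  show "e \<in> {1, 2, 3, 4}" if "m \<in> {1, 2, 3, 4}" "e dvd m" for m e :: nat
    using small_divisors[of e m] that by auto
  show "\<exists>m\<in>{1, 2, 3, 4}. cos (real m * \<theta>) = 1"
    if "A \<in> octa_group" "trace A = 1 + 2 * cos \<theta>" for A \<theta>
  proof -
    have "1 + 2 * cos \<theta> \<in> {3, - 1, 0, 1}"
      using trace_octa_group[OF that(1)] that(2) by auto
    then show ?thesis using cos_multiple_eq_1_of_trace(1-4)[of \<theta>] by blast
  qed
  show "\<exists>u. u \<noteq> 0 \<and> rot u (2 * pi / real m) \<in> octa_group \<and>
      (\<forall>m'\<in>{1, 2, 3, 4}. m dvd m' \<longrightarrow> rot u (2 * pi / real m') \<in> octa_group \<longrightarrow> m' = m)"
    if m: "m \<in> {1, 2, 3, 4}" for m :: nat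
  proof -
    consider "m = 1" | "m = 2" | "m = 3" | "m = 4" using m by blast
    then show ?thesis
    proof cases
      case 1
      show ?thesis unfolding 1
        using subgroup.one_closed[OF octa_group_rotations(1)]
        by (intro exists_trivial_axis finite_octa_group) auto
    next
      case 2
      then show ?thesis
        using octa_edge_axis by (intro exI[of _ "e1 + e2"]) (simp add: axis_nonzero)
    next
      case 3
      then show ?thesis by (intro exI[of _ "e1 + e2 + e3"]) (simp add: axis_nonzero generators_in_groups)
    next
      case 4
      then show ?thesis by (intro exI[of _ e3]) (simp add: axis_nonzero generators_in_groups)
    qed
  qed
qed simp_all

lemma Z_rot_1: "Z_rot 1 = triv_group"
  by (auto simp: Z_rot_def triv_group_def rot_e3_0)

text \<open>
  For odd \<open>p\<close> the index \<open>2 * n / p\<close> is even, so only proper rotations remain.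
\<close>

lemma Z_minus_subgroup_small:
  assumes "n > 0"
  shows "Z_minus_subgroup n 1 = triv_group"
    and "Z_minus_subgroup n 2 = (if even n then Z_rot 2 else Z_minus 2)"
    and "odd p \<Longrightarrow> p dvd 2 * n \<Longrightarrow> Z_minus_subgroup n p = Z_rot p"
    and "even n \<Longrightarrow> Z_minus_subgroup n 4 = (if 4 dvd n then Z_rot 4 else Z_minus 4)"
proof -
  show "Z_minus_subgroup n 1 = triv_group"
    using Z_rot_1 by (simp add: Z_minus_subgroup_def)
  show "Z_minus_subgroup n 2 = (if even n then Z_rot 2 else Z_minus 2)"
    by (simp add: Z_minus_subgroup_def)
  show "Z_minus_subgroup n p = Z_rot p" if p: "odd p" "p dvd 2 * n"
  proof -
    have "p * (2 * n div p) = 2 * n" using p(2) by simp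
    then have "even (p * (2 * n div p))" by simp
    then have "even (2 * n div p)" using p(1) by simp
    then show ?thesis by (simp add: Z_minus_subgroup_def)
  qed
  show "Z_minus_subgroup n 4 = (if 4 dvd n then Z_rot 4 else Z_minus 4)" if ev: "even n"
  proof -
    obtain k where k: "n = 2 * k" using ev by blast
    have "4 dvd n \<longleftrightarrow> even k" unfolding k by presburger
    then show ?thesis using k by (simp add: Z_minus_subgroup_def)
  qed
qed

lemma dvd_double:
  "3 dvd 2 * (n::nat) \<longleftrightarrow> 3 dvd n" "5 dvd 2 * n \<longleftrightarrow> 5 dvd n" "4 dvd 2 * n \<longleftrightarrow> even n"
  by presburger+

lemma gcd_3_5:
  "gcd 3 (n::nat) = (if 3 dvd n then 3 else 1)" "gcd 5 n = (if 5 dvd n then 5 else 1)"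
proof -
  have *: "gcd p n = (if p dvd n then p else 1)" if "prime p" for p
    using prime_imp_coprime[OF that, of n] by (auto simp: gcd_nat.absorb1)
  show "gcd 3 n = (if 3 dvd n then 3 else 1)" "gcd 5 n = (if 5 dvd n then 5 else 1)"
    by (rule *, simp)+
qed

theorem lemma4p5:
  fixes n d3 d5 :: nat and \<Z> :: "(real^3^3) set set"
  assumes "n \<ge> 1"
    and "d3 = gcd 3 n" and "d5 = gcd 5 n"
    and "\<Z> = (if even n then conj_class (Z_rot 2) else conj_class (Z_minus 2))"
  shows "(conj_class (Z_minus (2 * n)) clips conj_class (oplus_Z2c tetra_group)
           = {conj_class triv_group, conj_class (Z_rot d3), \<Z>})
    \<and> (conj_class (Z_minus (2 * n)) clips conj_class (oplus_Z2c icosa_group)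
           = {conj_class triv_group, \<Z>, conj_class (Z_rot d3), conj_class (Z_rot d5)})
    \<and> (conj_class (Z_minus (2 * n)) clips conj_class (oplus_Z2c octa_group)
           = (if even n \<and> 4 dvd n then
                {conj_class triv_group, conj_class (Z_rot 2), conj_class (Z_rot d3), conj_class (Z_rot 4)}
              else if even n \<and> \<not> 4 dvd n then
                {conj_class triv_group, conj_class (Z_rot 2), conj_class (Z_rot d3), conj_class (Z_minus 4)}
              else
                {conj_class triv_group, conj_class (Z_minus 2), conj_class (Z_rot d3)}))"
proof -
  have n: "n > 0" using assms(1) by simp
  let ?c = "\<lambda>e. conj_class (Z_minus_subgroup n e)"
  have c1: "?c 1 = conj_class triv_group"
    and c2: "?c 2 = \<Z>"
    and c4: "even n \<Longrightarrow> ?c 4 = (if 4 dvd n then conj_class (Z_rot 4) else conj_class (Z_minus 4))"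
    using Z_minus_subgroup_small(1,2,4)[OF n] assms(4) by auto
  \<comment> \<open>The trivial class is added because it is the class of \<open>Z_rot d3\<close> when 3 does not divide \<open>n\<close>.\<close>
  have A3: "?c ` {e \<in> {3}. e dvd 2 * n} \<union> {conj_class triv_group} = {conj_class triv_group, conj_class (Z_rot d3)}"
    using Z_minus_subgroup_small(3)[OF n, of 3] Z_rot_1
    by (auto simp: assms(2) gcd_3_5 dvd_double)
  have A5: "?c ` {e \<in> {5}. e dvd 2 * n} \<union> {conj_class triv_group} = {conj_class triv_group, conj_class (Z_rot d5)}"
    using Z_minus_subgroup_small(3)[OF n, of 5] Z_rot_1
    by (auto simp: assms(3) gcd_3_5 dvd_double)
  have "{e \<in> {1, 2}. e dvd 2 * n} = {1, 2}" by auto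
  then have A12: "?c ` {e \<in> {1, 2}. e dvd 2 * n} = {conj_class triv_group, \<Z>}"
    by (simp only: image_insert image_empty c1 c2)
  have A4: "?c ` {e \<in> {4}. e dvd 2 * n} = (if even n then
      if 4 dvd n then {conj_class (Z_rot 4)} else {conj_class (Z_minus 4)} else {})"
  proof -
    have "{e \<in> {4}. e dvd 2 * n} = (if even n then {4} else {})"
      using dvd_double(3) by auto
    then show ?thesis using c4 by simp
  qed
  have split: "{e \<in> {1, 2, 3}. e dvd 2 * n} = {e \<in> {1, 2}. e dvd 2 * n} \<union> {e \<in> {3}. e dvd 2 * n}"
    "{e \<in> {1, 2, 3, 5}. e dvd 2 * n}
      = {e \<in> {1, 2}. e dvd 2 * n} \<union> {e \<in> {3}. e dvd 2 * n} \<union> {e \<in> {5}. e dvd 2 * n}"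
    "{e \<in> {1, 2, 3, 4}. e dvd 2 * n}
      = {e \<in> {1, 2}. e dvd 2 * n} \<union> {e \<in> {3}. e dvd 2 * n} \<union> {e \<in> {4}. e dvd 2 * n}"
    by blast+
  have merge: "{t, z} \<union> X = {t, d, z}" "{t, z} \<union> X \<union> Y = {t, z, d} \<union> Y"
    if "X \<union> {t} = {t, d}" for t z d and X Y :: "(real^3^3) set set set"
    using that by blast+
  have tetra: "conj_class (Z_minus (2 * n)) clips conj_class (oplus_Z2c tetra_group)
      = {conj_class triv_group, conj_class (Z_rot d3), \<Z>}"
    unfolding clips_tetra[OF n] split image_Un A12 by (rule merge(1)[OF A3])
  have icosa: "conj_class (Z_minus (2 * n)) clips conj_class (oplus_Z2c icosa_group)
      = {conj_class triv_group, \<Z>, conj_class (Z_rot d3), conj_class (Z_rot d5)}"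
    unfolding clips_icosa[OF n] split image_Un A12 merge(2)[OF A3] using A5 by blast
  have "conj_class (Z_minus (2 * n)) clips conj_class (oplus_Z2c octa_group)
      = {conj_class triv_group, \<Z>, conj_class (Z_rot d3)} \<union>
        (if even n then if 4 dvd n then {conj_class (Z_rot 4)} else {conj_class (Z_minus 4)} else {})"
    unfolding clips_octa[OF n] split image_Un A12 merge(2)[OF A3] A4 ..
  then show ?thesis
    using tetra icosa assms(4) by auto
qed

end
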